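(* Suppose that $m,n\to\infty$ (with $m=m(n)$, $0\le m\le\binom n2$), let $p=p(n):=m/\binom n2$, and assume $\liminf p(n)>0$. Then, for any distinct vertices $s,a,b$ of the random directed graph $\vec G(n,m)$, \[ \operatorname{Cov}(s\not\to a,\ b\not\to s) =\left(\frac{3}{4-2p}\,e^{-\frac{2p(1-p)}{(2-p)^2}}-1+o(1)\right)\mathbb P(s\not\to a)^2 \] \[ =\left(3\, e^{-\frac{2p(1-p)}{(2-p)^2}}-4+2p+o(1)\right)(1-p/2)^{2n-3}\, e^{-\frac{2p(1-p)}{(2-p)^2}} . \]
   Context: For $0\le m\le \binom n2$, $G(n,m)$ is the random graph with $n$ labelled vertices $1,\dots,n$ and $m$ edges, uniformly chosen among all such graphs. $\vec G(n,m)$ is the random directed graph obtained from $G(n,m)$ by giving each edge one of its two orientations with probability $1/2$ each, independently of everything else. All probabilities are in the combined (annealed) probability space of the random graph and the orientations. For vertices $u,v$, $\{u\to v\}$ is the event that there is a directed path from $u$ to $v$, and $\{u\not\to v\}$ is its complement. For events $A,B$, $\operatorname{Cov}(A,B):=\mathbb P(A\cap B)-\mathbb P(A)\mathbb P(B)$. Limits and $o(1)$ are as $n\to\infty$. *)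

theory Defs
  imports "HOL-Probability.Probability" "HOL-Library.Landau_Symbols"
begin

definition all_edges :: "nat \<Rightarrow> nat set set" where
  "all_edges n = {e. e \<subseteq> {1..n} \<and> card e = 2}"

text \<open>The edge set of the uniform random graph on the labelled vertices \<open>1, \<dots>, n\<close>.
  It is meaningful only for \<open>m \<le> n choose 2\<close>, when the set of outcomes is nonempty.\<close>

definition Gnm :: "nat \<Rightarrow> nat \<Rightarrow> nat set set pmf" where
  "Gnm n m = pmf_of_set {E. E \<subseteq> all_edges n \<and> card E = m}"

text \<open>An orientation is encoded by one bit per edge: \<open>True\<close> directs the edge from its
  smaller to its larger endpoint, \<open>False\<close> from the larger to the smaller one.\<close>

definition arcs_of :: "nat set set \<Rightarrow> (nat set \<Rightarrow> bool) \<Rightarrow> (nat \<times> nat) set" where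
  "arcs_of E \<omega> = {(u, v). u \<noteq> v \<and> {u, v} \<in> E \<and> (\<omega> {u, v} \<longleftrightarrow> u < v)}"

definition random_orientation :: "nat set set \<Rightarrow> (nat \<times> nat) set pmf" where
  "random_orientation E =
     map_pmf (arcs_of E) (Pi_pmf E False (\<lambda>_. bernoulli_pmf (1 / 2)))"

text \<open>The annealed law: the graph and the orientations are both random.\<close>

definition directed_Gnm :: "nat \<Rightarrow> nat \<Rightarrow> (nat \<times> nat) set pmf" where
  "directed_Gnm n m = bind_pmf (Gnm n m) random_orientation"

definition dipath :: "(nat \<times> nat) set \<Rightarrow> nat \<Rightarrow> nat list \<Rightarrow> nat \<Rightarrow> bool" where
  "dipath D u xs v \<longleftrightarrow>
     xs \<noteq> [] \<and> hd xs = u \<and> last xs = v \<and> distinct xs \<and> successively (\<lambda>x y. (x, y) \<in> D) xs"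

definition no_path :: "nat \<Rightarrow> nat \<Rightarrow> (nat \<times> nat) set set" where
  "no_path u v = {D. \<not> (\<exists>xs. dipath D u xs v)}"

definition Cov :: "'a measure \<Rightarrow> 'a set \<Rightarrow> 'a set \<Rightarrow> real" where
  "Cov M A B = measure M (A \<inter> B) - measure M A * measure M B"

end

theory Submission
  imports Defs "HOL-Real_Asymp.Real_Asymp"
begin

text \<open>Let \<open>p\<close> be the edge density and \<open>x = 1 - p / 2\<close>. A vertex \<open>s\<close> fails to reach \<open>a\<close> iff some set \<open>S\<close> with
\<open>s \<in> S\<close> and \<open>a \<notin> S\<close> is left by no arc. Both probabilities in the covariance are therefore probabilities
that some member of a family of arc sets is avoided altogether. Given the undirected graph, the
orientations are independent, so an edge contributes a factor \<open>1\<close>, \<open>1/2\<close> or \<open>0\<close> according to the number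
of its two directions that are forbidden. If \<open>k\<close> edges are each forbidden in one direction, the
probability of avoidance depends on \<open>k\<close> only; call it \<open>Q k\<close> (\<open>one_way_avoidance\<close>). Because edges of the
uniform graph are negatively correlated, \<open>Q k \<le> x ^ k\<close>, and a similar product bound holds for every
forbidden set (\<open>prob_avoid_le\<close>).

A chain of sets that no arc leaves is a colouring of the vertices by levels such that no arc climbs to
a higher level. The number of forbidden edges is the number of two-coloured pairs, so the union bound over
chains is a partition function of Potts type with weight \<open>x\<close> per two-coloured pair. As \<open>x\<close> stays away from
\<open>1\<close>, only the colourings that are constant away from the prescribed root vertices survive
(\<open>potts_sum_bound\<close>). With \<open>r\<close> levels there are \<open>r\<close> of these, they nearly exclude each other, and each has the same
probability. For the chain \<open>s, a\<close> this gives \<open>2 Q (n - 1)\<close>: either \<open>s\<close> has no arc going out or \<open>a\<close> has no arc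
coming in. For the chain \<open>b, s, a\<close> it gives \<open>3 Q (2 n - 3)\<close>.

The event that \<open>s\<close> does not reach \<open>a\<close> and \<open>b\<close> does not reach \<open>s\<close> is the chain event for \<open>b, s, a\<close>, except
for configurations with two incomparable closed sets, one containing \<open>s\<close> alone and the other containing
\<open>a\<close> and \<open>b\<close> of the three. These constrain so many more edges that they are negligible
(\<open>prob_twin_event\<close>).

Finally, \<open>Q k\<close> differs from \<open>x ^ k\<close> by a constant factor, since the edges are drawn without replacement:
\<open>Q k / x ^ k\<close> tends to \<open>exp (- c * g)\<close> with \<open>g = p (1 - p) / (2 - p)\<^sup>2\<close> when \<open>k\<^sup>2\<close> divided by twice the number of
pairs tends to \<open>c\<close> (\<open>one_way_avoidance_approx\<close>). Here \<open>c = 1\<close> for \<open>k = n - 1\<close> and \<open>c = 4\<close> for \<open>k = 2 n - 3\<close>. Hence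
the joint probability divided by the squared single one behaves like
\<open>3 Q (2 n - 3) / (2 Q (n - 1))\<^sup>2\<close>, and this like \<open>3 / (4 x) * exp (- 2 g)\<close>.\<close>

section \<open>Avoiding a set of arcs\<close>

definition avoid :: "(nat \<times> nat) set \<Rightarrow> (nat \<times> nat) set set" where
  "avoid F = {D. D \<inter> F = {}}"

text \<open>
The conditional probability, given that \<open>e\<close> is an edge, that its random direction is not an arc of \<open>F\<close>.
\<close>

definition edge_weight :: "(nat \<times> nat) set \<Rightarrow> nat set \<Rightarrow> real" where
  "edge_weight F e = (of_bool ((Min e, Max e) \<notin> F) + of_bool ((Max e, Min e) \<notin> F)) / 2"

lemma edge_weight_pair:
  assumes "u \<noteq> v"
  shows "edge_weight F {u, v} = (of_bool ((u, v) \<notin> F) + of_bool ((v, u) \<notin> F)) / 2"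
  using assms by (cases "u < v") (auto simp: edge_weight_def min_def max_def)

lemma edge_weight_bounds: "0 \<le> edge_weight F e" "edge_weight F e \<le> 1"
  by (auto simp: edge_weight_def)

lemma finite_all_edges: "finite (all_edges n)"
  by (rule finite_subset[of _ "Pow {1..n}"]) (auto simp: all_edges_def)

lemma card_all_edges: "card (all_edges n) = n choose 2"
  unfolding all_edges_def by (subst n_subsets) auto

lemma all_edges_pair_iff: "u \<noteq> v \<Longrightarrow> {u, v} \<in> all_edges n \<longleftrightarrow> u \<in> {1..n} \<and> v \<in> {1..n}"
  by (auto simp: all_edges_def)

lemma all_edges_elim:
  assumes "e \<in> all_edges n"
  obtains u v where "u \<in> {1..n}" "v \<in> {1..n}" "u \<noteq> v" "e = {u, v}"
  using assms by (auto simp: all_edges_def card_2_iff)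

lemma prob_random_orientation_avoid:
  assumes "E \<subseteq> all_edges n"
  shows "measure_pmf.prob (random_orientation E) (avoid F) = (\<Prod>e\<in>E. edge_weight F e)"
proof -
  have fin: "finite E"
    using assms finite_all_edges finite_subset by blast
  define B where "B e = {b. if b then (Min e, Max e) \<notin> F else (Max e, Min e) \<notin> F}" for e
  have iff: "arcs_of E \<omega> \<in> avoid F \<longleftrightarrow> \<omega> \<in> Pi E B" for \<omega>
  proof -
    have "arcs_of E \<omega> \<in> avoid F \<longleftrightarrow>
        (\<forall>e\<in>E. \<forall>u v. u \<noteq> v \<longrightarrow> e = {u, v} \<longrightarrow> (\<omega> e \<longleftrightarrow> u < v) \<longrightarrow> (u, v) \<notin> F)"
      unfolding avoid_def arcs_of_def by blast
    also have "\<dots> \<longleftrightarrow> (\<forall>e\<in>E. \<omega> e \<in> B e)"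
    proof (rule ball_cong[OF refl])
      fix e assume "e \<in> E"
      then obtain u v where uv: "u < v" "e = {u, v}"
        using assms by (metis all_edges_elim insert_commute linorder_neqE_nat subsetD)
      then have "Min e = u" "Max e = v" by auto
      moreover have "x \<noteq> y \<Longrightarrow> e = {x, y} \<longleftrightarrow> x = u \<and> y = v \<or> x = v \<and> y = u" for x y
        using uv by (auto simp: doubleton_eq_iff)
      ultimately show "(\<forall>x y. x \<noteq> y \<longrightarrow> e = {x, y} \<longrightarrow> (\<omega> e \<longleftrightarrow> x < y) \<longrightarrow> (x, y) \<notin> F) \<longleftrightarrow> \<omega> e \<in> B e"
        using uv(1) unfolding B_def by (auto split: if_splits)
    qed
    finally show ?thesis by (auto simp: Pi_def)
  qed
  have prB: "measure_pmf.prob (bernoulli_pmf (1 / 2)) (B e) = edge_weight F e" for e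
  proof -
    have "B e = (if (Min e, Max e) \<notin> F then {True} else {}) \<union>
                (if (Max e, Min e) \<notin> F then {False} else {})"
      by (auto simp: B_def split: if_splits)
    then show ?thesis
      by (auto simp: measure_measure_pmf_finite edge_weight_def)
  qed
  have "measure_pmf.prob (random_orientation E) (avoid F) =
      measure_pmf.prob (Pi_pmf E False (\<lambda>_. bernoulli_pmf (1 / 2))) (Pi E B)"
    unfolding random_orientation_def measure_map_pmf
    by (rule arg_cong[where f = "measure _"]) (auto simp: iff simp del: Pi_iff)
  also have "\<dots> = (\<Prod>e\<in>E. edge_weight F e)"
    by (subst measure_Pi_pmf_Pi[OF fin]) (simp add: prB)
  finally show ?thesis .
qed

abbreviation edge_sets :: "nat \<Rightarrow> nat \<Rightarrow> nat set set set" where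
  "edge_sets n m \<equiv> {E. E \<subseteq> all_edges n \<and> card E = m}"

lemma edge_sets_props:
  assumes "m \<le> n choose 2"
  shows "finite (edge_sets n m)" "edge_sets n m \<noteq> {}" "card (edge_sets n m) = (n choose 2) choose m"
proof -
  show "finite (edge_sets n m)"
    by (rule finite_subset[of _ "Pow (all_edges n)"]) (auto simp: finite_all_edges)
  show card: "card (edge_sets n m) = (n choose 2) choose m"
    using n_subsets[OF finite_all_edges, of n m] by (simp add: card_all_edges)
  have "card (edge_sets n m) > 0" using assms by (simp add: card)
  then show "edge_sets n m \<noteq> {}" by (metis card.empty less_irrefl)
qed

lemma prob_directed_Gnm:
  assumes "m \<le> n choose 2"
  shows "measure_pmf.prob (directed_Gnm n m) X =
    (\<Sum>E\<in>edge_sets n m. measure_pmf.prob (random_orientation E) X) / ((n choose 2) choose m)"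
proof -
  note fs = edge_sets_props[OF assms]
  have "measure_pmf.prob (directed_Gnm n m) X =
     (\<integral>E. measure_pmf.prob (random_orientation E) X \<partial>measure_pmf (Gnm n m))"
    unfolding directed_Gnm_def
    by (subst measure_pmf_bind, subst measure_pmf.measure_bind[where N = "count_space UNIV"])
       (auto simp: space_subprob_algebra intro: prob_space_imp_subprob_space measure_pmf.prob_space_axioms)
  also have "\<dots> = (\<Sum>E\<in>edge_sets n m. measure_pmf.prob (random_orientation E) X) / card (edge_sets n m)"
    unfolding Gnm_def using fs by (subst integral_pmf_of_set) auto
  finally show ?thesis by (simp only: fs(3))
qed

lemma prob_avoid_sum:
  assumes "m \<le> n choose 2"
  shows "measure_pmf.prob (directed_Gnm n m) (avoid F) =
    (\<Sum>E\<in>edge_sets n m. \<Prod>e\<in>E. edge_weight F e) / ((n choose 2) choose m)"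
  unfolding prob_directed_Gnm[OF assms]
  by (intro arg_cong2[where f = "(/)"] sum.cong refl prob_random_orientation_avoid[of _ n]) auto

text \<open>
The probability that a uniform \<open>m\<close>-subset of an \<open>N\<close>-set misses a fixed set of size \<open>i\<close>.
\<close>

definition miss :: "nat \<Rightarrow> nat \<Rightarrow> nat \<Rightarrow> real" where
  "miss N m i = real ((N - i) choose m) / real (N choose m)"

lemma miss_nonneg: "0 \<le> miss N m i"
  by (simp add: miss_def)

lemma miss_0: "m \<le> N \<Longrightarrow> miss N m 0 = 1"
  by (simp add: miss_def)

lemma miss_Suc:
  assumes "i < N" "m \<le> N"
  shows "miss N m (Suc i) = miss N m i * (1 - real m / real (N - i))"
proof -
  define K where "K = N - Suc i"
  have K: "N - i = Suc K" "N - Suc i = K" using assms by (auto simp: K_def)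
  have "real (K choose m) = real (Suc K choose m) * (1 - real m / real (Suc K))"
  proof (cases "m \<le> Suc K")
    case True
    have "(Suc K - m) * (Suc K choose m) = Suc K * (K choose m)"
      using binomial_absorb_comp[of "Suc K" m] by simp
    then have "real (Suc K - m) * real (Suc K choose m) = real (Suc K) * real (K choose m)"
      by (metis of_nat_mult)
    moreover have "real (Suc K - m) = real (Suc K) - real m"
      using True by (simp add: of_nat_diff)
    ultimately show ?thesis
      by (simp add: field_simps del: of_nat_Suc)
  next
    case False
    then show ?thesis by (simp add: binomial_eq_0)
  qed
  then show ?thesis unfolding miss_def K by simp
qed

text \<open>
If \<open>m > N - i\<close>, the product contains the factor \<open>0\<close>, so that the negative factors after it do no harm.
\<close>

lemma miss_prod:
  assumes "i \<le> N" "m \<le> N"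
  shows "miss N m i = (\<Prod>l<i. 1 - real m / real (N - l))"
  using assms(1)
proof (induction i)
  case (Suc i)
  then show ?case using miss_Suc[of i N m] assms(2) by simp
qed (simp add: miss_0 assms(2))

lemma miss_le:
  assumes "i \<le> N" "m \<le> N"
  shows "miss N m i \<le> (1 - real m / real N) ^ i"
  using assms(1)
proof (induction i)
  case (Suc i)
  have q: "0 \<le> 1 - real m / real N" using assms Suc.prems by (simp add: field_simps)
  have "1 - real m / real (N - i) \<le> 1 - real m / real N"
    using Suc.prems by (auto intro!: divide_left_mono)
  then have "miss N m (Suc i) \<le> miss N m i * (1 - real m / real N)"
    unfolding miss_Suc[OF Suc_le_lessD[OF Suc.prems] assms(2)]
    by (intro mult_left_mono miss_nonneg)
  also have "\<dots> \<le> (1 - real m / real N) ^ i * (1 - real m / real N)"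
    using Suc q by (intro mult_right_mono) auto
  finally show ?case by (simp add: mult.commute)
qed (simp add: miss_0 assms(2))

text \<open>
Writing each factor as \<open>w e\<close> plus \<open>1 - w e\<close> times the indicator that \<open>e\<close> is absent, and expanding the product
over all pairs, turns the expectation into a combination of miss probabilities. For weights between \<open>0\<close> and \<open>1\<close>
all its coefficients are nonnegative, so that bounds on miss probabilities carry over.
\<close>

lemma sum_prod_edge_sets:
  fixes w :: "nat set \<Rightarrow> real"
  assumes "m \<le> n choose 2"
  shows "(\<Sum>E\<in>edge_sets n m. \<Prod>e\<in>E. w e) / ((n choose 2) choose m) =
    (\<Sum>T\<in>Pow (all_edges n). (\<Prod>e\<in>T. 1 - w e) * (\<Prod>e\<in>all_edges n - T. w e) * miss (n choose 2) m (card T))"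
proof -
  let ?A = "all_edges n"
  have "(\<Prod>e\<in>E. w e) = (\<Sum>T\<in>Pow ?A. (\<Prod>e\<in>T. 1 - w e) * (\<Prod>e\<in>?A - T. w e) * of_bool (T \<inter> E = {}))"
    if "E \<subseteq> ?A" for E
  proof -
    have "(\<Prod>e\<in>E. w e) = (\<Prod>e\<in>?A. (1 - w e) * of_bool (e \<notin> E) + w e)"
    proof -
      have "(\<Prod>e\<in>?A. (1 - w e) * of_bool (e \<notin> E) + w e) = (\<Prod>e\<in>?A. if e \<in> E then w e else 1)"
        by (rule prod.cong) auto
      also have "\<dots> = (\<Prod>e\<in>?A \<inter> E. w e)"
        by (subst prod.inter_restrict) (auto simp: finite_all_edges)
      finally show ?thesis using that by (simp add: Int_absorb1)
    qed
    also have "\<dots> = (\<Sum>T\<in>Pow ?A. (\<Prod>e\<in>T. (1 - w e) * of_bool (e \<notin> E)) * (\<Prod>e\<in>?A - T. w e))"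
      by (rule prod_add[OF finite_all_edges])
    also have "\<dots> = (\<Sum>T\<in>Pow ?A. (\<Prod>e\<in>T. 1 - w e) * (\<Prod>e\<in>?A - T. w e) * of_bool (T \<inter> E = {}))"
    proof (rule sum.cong[OF refl])
      fix T assume "T \<in> Pow ?A"
      then have fT: "finite T" using finite_all_edges finite_subset by blast
      have "(\<Prod>e\<in>T. of_bool (e \<notin> E) :: real) = of_bool (T \<inter> E = {})"
      proof (cases "T \<inter> E = {}")
        case True
        then have "(\<Prod>e\<in>T. of_bool (e \<notin> E) :: real) = (\<Prod>e\<in>T. 1)"
          by (intro prod.cong) auto
        then show ?thesis using True by simp
      next
        case False
        then show ?thesis using fT by auto
      qed
      then show "(\<Prod>e\<in>T. (1 - w e) * of_bool (e \<notin> E)) * (\<Prod>e\<in>?A - T. w e) =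
         (\<Prod>e\<in>T. 1 - w e) * (\<Prod>e\<in>?A - T. w e) * of_bool (T \<inter> E = {})"
        by (simp only: prod.distrib mult_ac)
    qed
    finally show ?thesis .
  qed
  then have "(\<Sum>E\<in>edge_sets n m. \<Prod>e\<in>E. w e) =
     (\<Sum>E\<in>edge_sets n m. \<Sum>T\<in>Pow ?A. (\<Prod>e\<in>T. 1 - w e) * (\<Prod>e\<in>?A - T. w e) * of_bool (T \<inter> E = {}))"
    by (intro sum.cong) auto
  also have "\<dots> = (\<Sum>T\<in>Pow ?A. (\<Prod>e\<in>T. 1 - w e) * (\<Prod>e\<in>?A - T. w e) *
       (\<Sum>E\<in>edge_sets n m. of_bool (T \<inter> E = {})))"
    by (subst sum.swap) (simp add: sum_distrib_left)
  also have "\<dots> = (\<Sum>T\<in>Pow ?A. (\<Prod>e\<in>T. 1 - w e) * (\<Prod>e\<in>?A - T. w e) *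
       (miss (n choose 2) m (card T) * ((n choose 2) choose m)))"
  proof (rule sum.cong[OF refl], rule arg_cong2[where f = "(*)"], rule refl)
    fix T assume T: "T \<in> Pow ?A"
    then have fT: "finite T" using finite_all_edges finite_subset by blast
    have "(\<Sum>E\<in>edge_sets n m. of_bool (T \<inter> E = {}) :: real) = card {E. E \<subseteq> ?A - T \<and> card E = m}"
      using edge_sets_props(1)[OF assms]
      by (simp add: sum.If_cases of_bool_def if_distrib)
         (intro arg_cong[where f = card], auto)
    also have "card {E. E \<subseteq> ?A - T \<and> card E = m} = (card (?A - T)) choose m"
      by (rule n_subsets) (simp add: finite_all_edges)
    also have "card (?A - T) = (n choose 2) - card T"
      using T fT by (simp add: card_Diff_subset card_all_edges)
    finally show "(\<Sum>E\<in>edge_sets n m. of_bool (T \<inter> E = {}) :: real) =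
        miss (n choose 2) m (card T) * ((n choose 2) choose m)"
      using assms by (simp add: miss_def)
  qed
  also have "\<dots> = (\<Sum>T\<in>Pow ?A. (\<Prod>e\<in>T. 1 - w e) * (\<Prod>e\<in>?A - T. w e) *
       miss (n choose 2) m (card T)) * ((n choose 2) choose m)"
    by (simp only: sum_distrib_right mult.assoc)
  finally show ?thesis using assms by simp
qed

text \<open>
Negative correlation: the uniform graph is at least as unlikely to avoid \<open>F\<close> as the graph with independent edges of
the same density. Missing a set has at most its independent probability (\<open>miss_le\<close>), and after this
replacement the expansion of \<open>sum_prod_edge_sets\<close> folds back into a product.
\<close>

lemma prob_avoid_le:
  assumes "m \<le> n choose 2" and p: "p = real m / real (n choose 2)"
  shows "measure_pmf.prob (directed_Gnm n m) (avoid F) \<le>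
    (\<Prod>e\<in>all_edges n. 1 - p + p * edge_weight F e)"
proof -
  let ?A = "all_edges n" and ?w = "edge_weight F" and ?N = "n choose 2"
  have "measure_pmf.prob (directed_Gnm n m) (avoid F) =
    (\<Sum>T\<in>Pow ?A. (\<Prod>e\<in>T. 1 - ?w e) * (\<Prod>e\<in>?A - T. ?w e) * miss ?N m (card T))"
    unfolding prob_avoid_sum[OF assms(1)] by (rule sum_prod_edge_sets[OF assms(1)])
  also have "\<dots> \<le> (\<Sum>T\<in>Pow ?A. (\<Prod>e\<in>T. 1 - ?w e) * (\<Prod>e\<in>?A - T. ?w e) * (1 - p) ^ card T)"
  proof (rule sum_mono)
    fix T assume "T \<in> Pow ?A"
    then have "card T \<le> ?N"
      using card_mono[OF finite_all_edges, of T n] by (simp add: card_all_edges)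
    then have "miss ?N m (card T) \<le> (1 - p) ^ card T"
      unfolding p using miss_le assms(1) by blast
    then show "(\<Prod>e\<in>T. 1 - ?w e) * (\<Prod>e\<in>?A - T. ?w e) * miss ?N m (card T) \<le>
      (\<Prod>e\<in>T. 1 - ?w e) * (\<Prod>e\<in>?A - T. ?w e) * (1 - p) ^ card T"
      by (intro mult_left_mono mult_nonneg_nonneg prod_nonneg) (auto simp: edge_weight_bounds)
  qed
  also have "\<dots> = (\<Sum>T\<in>Pow ?A. (\<Prod>e\<in>T. (1 - p) * (1 - ?w e)) * (\<Prod>e\<in>?A - T. ?w e))"
    by (simp only: prod.distrib prod_constant mult_ac)
  also have "\<dots> = (\<Prod>e\<in>?A. (1 - p) * (1 - ?w e) + ?w e)"
    by (rule prod_add[symmetric, OF finite_all_edges])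
  also have "\<dots> = (\<Prod>e\<in>?A. 1 - p + p * ?w e)"
    by (simp add: algebra_simps)
  finally show ?thesis .
qed

definition one_way_avoidance :: "nat \<Rightarrow> nat \<Rightarrow> nat \<Rightarrow> real" where
  "one_way_avoidance N m k = (\<Sum>i\<le>k. real (k choose i) * miss N m i) / 2 ^ k"

text \<open>
In the expansion over sets of missed pairs only the subsets of \<open>K\<close> have a nonzero coefficient, and it is the same for all of them.
\<close>

lemma prob_avoid_one_way:
  assumes m: "m \<le> n choose 2" and K: "K \<subseteq> all_edges n"
    and w: "\<And>e. e \<in> all_edges n \<Longrightarrow> edge_weight F e = (if e \<in> K then 1 / 2 else 1)"
  shows "measure_pmf.prob (directed_Gnm n m) (avoid F) = one_way_avoidance (n choose 2) m (card K)"
proof -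
  let ?A = "all_edges n" and ?w = "edge_weight F" and ?N = "n choose 2"
  have fK: "finite K" using K finite_all_edges finite_subset by blast
  have "measure_pmf.prob (directed_Gnm n m) (avoid F) =
    (\<Sum>T\<in>Pow ?A. (\<Prod>e\<in>T. 1 - ?w e) * (\<Prod>e\<in>?A - T. ?w e) * miss ?N m (card T))"
    unfolding prob_avoid_sum[OF m] by (rule sum_prod_edge_sets[OF m])
  also have "\<dots> = (\<Sum>T\<in>Pow K. (\<Prod>e\<in>T. 1 - ?w e) * (\<Prod>e\<in>?A - T. ?w e) * miss ?N m (card T))"
  proof (rule sum.mono_neutral_right)
    show "finite (Pow ?A)" by (simp add: finite_all_edges)
    show "Pow K \<subseteq> Pow ?A" using K by blast
    show "\<forall>T\<in>Pow ?A - Pow K. (\<Prod>e\<in>T. 1 - ?w e) * (\<Prod>e\<in>?A - T. ?w e) * miss ?N m (card T) = 0"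
    proof
      fix T assume T: "T \<in> Pow ?A - Pow K"
      then obtain e where e: "e \<in> T" "e \<notin> K" "e \<in> ?A" by blast
      have "finite T" using T finite_all_edges finite_subset by blast
      then have "(\<Prod>e\<in>T. 1 - ?w e) = 0"
        using e w[of e] by (intro prod_zero) auto
      then show "(\<Prod>e\<in>T. 1 - ?w e) * (\<Prod>e\<in>?A - T. ?w e) * miss ?N m (card T) = 0" by simp
    qed
  qed
  also have "\<dots> = (\<Sum>T\<in>Pow K. miss ?N m (card T) / 2 ^ card K)"
  proof (rule sum.cong[OF refl])
    fix T assume T: "T \<in> Pow K"
    then have fT: "finite T" and TA: "T \<subseteq> ?A" using K fK finite_subset by blast+
    have "1 - ?w e = 1 / 2" if "e \<in> T" for e
    proof -
      have "e \<in> K" "e \<in> ?A" using that T TA by auto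
      then show ?thesis using w by simp
    qed
    then have "(\<Prod>e\<in>T. 1 - ?w e) = (\<Prod>e\<in>T. 1 / 2)"
      by (rule prod.cong[OF refl])
    moreover have "(\<Prod>e\<in>?A - T. ?w e) = (\<Prod>e\<in>K - T. 1 / 2)"
    proof -
      have "(\<Prod>e\<in>?A - T. ?w e) = (\<Prod>e\<in>?A - T. if e \<in> K then 1 / 2 else 1)"
        by (rule prod.cong) (auto simp: w)
      also have "\<dots> = (\<Prod>e\<in>(?A - T) \<inter> K. 1 / 2)"
        by (subst prod.inter_restrict) (auto simp: finite_all_edges)
      also have "(?A - T) \<inter> K = K - T" using K by auto
      finally show ?thesis .
    qed
    moreover have "card K = card T + card (K - T)"
      using T fK fT card_Diff_subset[of T K] card_mono[of K T] by auto
    ultimately show "(\<Prod>e\<in>T. 1 - ?w e) * (\<Prod>e\<in>?A - T. ?w e) * miss ?N m (card T) =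
        miss ?N m (card T) / 2 ^ card K"
      by (simp add: power_add power_one_over)
  qed
  also have "\<dots> = (\<Sum>i\<le>card K. \<Sum>T\<in>{T\<in>Pow K. card T = i}. miss ?N m (card T) / 2 ^ card K)"
    by (rule sum.group[symmetric]) (use fK in \<open>auto simp: card_mono\<close>)
  also have "\<dots> = (\<Sum>i\<le>card K. real (card K choose i) * miss ?N m i / 2 ^ card K)"
  proof (rule sum.cong[OF refl])
    fix i
    have "(\<Sum>T\<in>{T\<in>Pow K. card T = i}. miss ?N m (card T) / 2 ^ card K) =
       (\<Sum>T\<in>{T. T \<subseteq> K \<and> card T = i}. miss ?N m i / 2 ^ card K)"
      by (rule sum.cong) auto
    then show "(\<Sum>T\<in>{T\<in>Pow K. card T = i}. miss ?N m (card T) / 2 ^ card K) =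
       real (card K choose i) * miss ?N m i / 2 ^ card K"
      by (simp add: n_subsets[OF fK])
  qed
  finally show ?thesis by (simp add: one_way_avoidance_def sum_divide_distrib)
qed

lemma one_way_avoidance_pos:
  assumes "m \<le> N"
  shows "0 < one_way_avoidance N m k"
proof -
  have "0 < real (k choose 0) * miss N m 0" by (simp add: miss_0 assms)
  then have "0 < (\<Sum>i\<le>k. real (k choose i) * miss N m i)"
    by (intro sum_pos2[of _ 0]) (auto intro!: mult_nonneg_nonneg miss_nonneg)
  then show ?thesis by (simp add: one_way_avoidance_def)
qed

section \<open>Invariance under relabelling\<close>

definition oriented_graphs :: "nat \<Rightarrow> nat \<Rightarrow> (nat \<times> nat) set set" where
  "oriented_graphs n m =
     {D. D \<subseteq> {1..n} \<times> {1..n} \<and> (\<forall>u v. (u, v) \<in> D \<longrightarrow> (v, u) \<notin> D) \<and> card D = m}"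

text \<open>
An oriented graph contains no pair of opposite arcs, hence forgetting directions is injective on its arcs.
\<close>

lemma card_underlying:
  assumes "finite D" "\<And>u v. (u, v) \<in> D \<Longrightarrow> (v, u) \<notin> D"
  shows "card ((\<lambda>(u, v). {u, v}) ` D) = card D"
  by (rule card_image) (use assms in \<open>fastforce simp: inj_on_def doubleton_eq_iff\<close>)

lemma set_directed_Gnm:
  assumes "m \<le> n choose 2"
  shows "set_pmf (directed_Gnm n m) \<subseteq> oriented_graphs n m"
proof
  fix D assume "D \<in> set_pmf (directed_Gnm n m)"
  then obtain E \<omega> where E: "E \<subseteq> all_edges n" "card E = m" and D: "D = arcs_of E \<omega>"
    using edge_sets_props[OF assms]
    by (auto simp: directed_Gnm_def Gnm_def random_orientation_def)
  have sub: "D \<subseteq> {1..n} \<times> {1..n}"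
    using E(1) unfolding D arcs_of_def all_edges_def by auto
  have asym: "(v, u) \<notin> D" if "(u, v) \<in> D" for u v
    using that unfolding D arcs_of_def by (auto simp: insert_commute)
  have "(\<lambda>(u, v). {u, v}) ` D = E"
  proof
    show "(\<lambda>(u, v). {u, v}) ` D \<subseteq> E" by (auto simp: D arcs_of_def)
    show "E \<subseteq> (\<lambda>(u, v). {u, v}) ` D"
    proof
      fix e assume e: "e \<in> E"
      then obtain u v where uv: "u < v" "e = {u, v}"
        using E(1) by (metis all_edges_elim insert_commute linorder_neqE_nat subsetD)
      show "e \<in> (\<lambda>(u, v). {u, v}) ` D"
      proof (cases "\<omega> e")
        case True
        then have "(u, v) \<in> D" using uv e by (auto simp: D arcs_of_def)
        then show ?thesis using uv(2) by force
      next
        case False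
        then have "(v, u) \<in> D" using uv e by (auto simp: D arcs_of_def insert_commute)
        then show ?thesis using uv(2) by force
      qed
    qed
  qed
  moreover have "finite D" using sub finite_subset by blast
  ultimately have "card D = m" using card_underlying[of D] asym E(2) by simp
  then show "D \<in> oriented_graphs n m" using sub asym by (simp add: oriented_graphs_def)
qed

text \<open>
A graph with \<open>m\<close> arcs equals \<open>D\<close> iff it avoids every arc outside \<open>D\<close>, and only one edge set gives that
avoidance a nonzero weight.
\<close>

lemma pmf_directed_Gnm:
  assumes m: "m \<le> n choose 2" and D: "D \<in> oriented_graphs n m"
  shows "pmf (directed_Gnm n m) D = 1 / (2 ^ m * ((n choose 2) choose m))"
proof -
  let ?V = "{1..n} \<times> {1..n}" and ?M = "directed_Gnm n m"
  define U where "U = (\<lambda>(u, v). {u, v}) ` D"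
  have sub: "D \<subseteq> ?V" and asym: "\<And>u v. (u, v) \<in> D \<Longrightarrow> (v, u) \<notin> D" and cD: "card D = m"
    using D by (auto simp: oriented_graphs_def)
  have fD: "finite D" using sub finite_subset by blast
  have cU: "card U = m" unfolding U_def using card_underlying[OF fD asym] cD by simp
  have fU: "finite U" unfolding U_def using fD by simp
  have irr: "u \<noteq> v" if "(u, v) \<in> D" for u v using asym that by blast
  have UA: "U \<subseteq> all_edges n"
    unfolding U_def using sub irr by (fastforce simp: all_edges_pair_iff)
  have w: "edge_weight (?V - D) e = (if e \<in> U then 1 / 2 else 0)" if "e \<in> all_edges n" for e
    using that
  proof (rule all_edges_elim)
    fix u v assume uv: "u \<in> {1..n}" "v \<in> {1..n}" "u \<noteq> v" "e = {u, v}"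
    have "e \<in> U \<longleftrightarrow> (u, v) \<in> D \<or> (v, u) \<in> D"
      unfolding U_def uv(4) by (force simp: doubleton_eq_iff)
    then show ?thesis
      using uv asym[of u v] asym[of v u] by (auto simp: edge_weight_pair)
  qed
  have "pmf ?M D = measure_pmf.prob ?M {D}" by (simp add: measure_pmf_single)
  also have "\<dots> = measure_pmf.prob ?M (avoid (?V - D))"
  proof (rule measure_prob_cong_0)
    fix x assume "x \<in> {D} - avoid (?V - D)"
    then show "pmf ?M x = 0" by (auto simp: avoid_def)
  next
    fix x assume x: "x \<in> avoid (?V - D) - {D}"
    show "pmf ?M x = 0"
    proof (rule ccontr)
      assume "pmf ?M x \<noteq> 0"
      then have "x \<in> oriented_graphs n m"
        using set_directed_Gnm[OF m] by (auto simp: set_pmf_iff)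
      then have "x \<subseteq> D" "card x = m" using x by (auto simp: avoid_def oriented_graphs_def)
      then have "x = D" using card_subset_eq[OF fD] cD by simp
      then show False using x by simp
    qed
  qed
  also have "\<dots> = (\<Sum>E\<in>edge_sets n m. \<Prod>e\<in>E. edge_weight (?V - D) e) / ((n choose 2) choose m)"
    by (rule prob_avoid_sum[OF m])
  also have "(\<Sum>E\<in>edge_sets n m. \<Prod>e\<in>E. edge_weight (?V - D) e) =
      (\<Sum>E\<in>edge_sets n m. if E = U then 1 / 2 ^ m else 0)"
  proof (rule sum.cong[OF refl])
    fix E assume E: "E \<in> edge_sets n m"
    then have fE: "finite E" using finite_all_edges finite_subset by blast
    show "(\<Prod>e\<in>E. edge_weight (?V - D) e) = (if E = U then 1 / 2 ^ m else 0)"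
    proof (cases "E \<subseteq> U")
      case True
      then have "E = U" using E cU card_subset_eq[OF fU] by auto
      have "(\<Prod>e\<in>U. edge_weight (?V - D) e) = (\<Prod>e\<in>U. 1 / 2)"
        using UA w by (intro prod.cong) auto
      then show ?thesis using \<open>E = U\<close> by (simp add: cU power_one_over)
    next
      case False
      then obtain e where "e \<in> E" "e \<notin> U" by blast
      moreover have "e \<in> all_edges n" using \<open>e \<in> E\<close> E by auto
      ultimately have "(\<Prod>e\<in>E. edge_weight (?V - D) e) = 0"
        using w[of e] fE by (intro prod_zero) auto
      then show ?thesis using False by auto
    qed
  qed
  also have "\<dots> = 1 / 2 ^ m"
    using edge_sets_props(1)[OF m] UA cU by simp
  finally show ?thesis by simp
qed

lemma prob_directed_Gnm_card:
  assumes "m \<le> n choose 2"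
  shows "measure_pmf.prob (directed_Gnm n m) X =
    card (oriented_graphs n m \<inter> X) / (2 ^ m * ((n choose 2) choose m))"
proof -
  let ?M = "directed_Gnm n m" and ?O = "oriented_graphs n m"
  have fin: "finite (?O \<inter> X)"
    by (rule finite_subset[of _ "Pow ({1..n} \<times> {1..n})"]) (auto simp: oriented_graphs_def)
  have "measure_pmf.prob ?M X = measure_pmf.prob ?M (?O \<inter> X)"
    by (rule measure_prob_cong_0) (use set_directed_Gnm[OF assms] in \<open>auto simp: set_pmf_iff\<close>)
  also have "\<dots> = (\<Sum>D\<in>?O \<inter> X. pmf ?M D)"
    by (rule measure_measure_pmf_finite[OF fin])
  also have "\<dots> = (\<Sum>D\<in>?O \<inter> X. 1 / (2 ^ m * ((n choose 2) choose m)))"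
    by (rule sum.cong) (auto simp: pmf_directed_Gnm[OF assms])
  finally show ?thesis by simp
qed

text \<open>
The law is uniform on the oriented graphs with \<open>m\<close> arcs, so an injection between two events compares
their probabilities.
\<close>

lemma prob_relabel_le:
  assumes m: "m \<le> n choose 2" and f: "bij_betw f {1..n} {1..n}"
    and XY: "\<And>D. D \<in> oriented_graphs n m \<Longrightarrow> D \<in> X \<Longrightarrow> map_prod f f ` D \<in> Y"
  shows "measure_pmf.prob (directed_Gnm n m) X \<le> measure_pmf.prob (directed_Gnm n m) Y"
proof -
  let ?O = "oriented_graphs n m" and ?V = "{1..n} \<times> {1..n}" and ?g = "\<lambda>D. map_prod f f ` D"
  have inj: "inj_on (map_prod f f) ?V"
    using f by (simp add: bij_betw_def map_prod_inj_on)
  have fin: "finite (?O \<inter> Y)"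
    by (rule finite_subset[of _ "Pow ?V"]) (auto simp: oriented_graphs_def)
  have "?g D \<in> ?O" if "D \<in> ?O" for D
  proof -
    have D: "D \<subseteq> ?V" "\<And>u v. (u, v) \<in> D \<Longrightarrow> (v, u) \<notin> D" "card D = m"
      using that by (auto simp: oriented_graphs_def)
    have "?g D \<subseteq> ?V" using D(1) f by (fastforce simp: bij_betw_def)
    moreover have "card (?g D) = m"
      using D(3) card_image[OF inj_on_subset[OF inj D(1)]] by simp
    moreover have "(v, u) \<notin> ?g D" if uv: "(u, v) \<in> ?g D" for u v
    proof
      assume "(v, u) \<in> ?g D"
      then obtain a b a' b' where ab: "(a, b) \<in> D" "u = f a" "v = f b" "(b', a') \<in> D" "u = f a'" "v = f b'"
        using uv by auto
      moreover from ab D(1) have "a = a'" "b = b'"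
        using f unfolding bij_betw_def inj_on_def by blast+
      ultimately show False using D(2) by blast
    qed
    ultimately show ?thesis by (simp add: oriented_graphs_def)
  qed
  then have "?g ` (?O \<inter> X) \<subseteq> ?O \<inter> Y" using XY by blast
  moreover have "inj_on ?g (?O \<inter> X)"
    by (rule inj_on_subset[OF inj_on_image_Pow[OF inj]]) (auto simp: oriented_graphs_def)
  ultimately have "card (?O \<inter> X) \<le> card (?O \<inter> Y)"
    using fin by (intro card_inj_on_le[of ?g])
  then show ?thesis
    by (simp add: prob_directed_Gnm_card[OF m] divide_right_mono)
qed

section \<open>Sampling without replacement\<close>

lemma miss_one: "0 < i \<Longrightarrow> i \<le> N \<Longrightarrow> miss N N i = 0"
  by (simp add: miss_def binomial_eq_0)

lemma exp_minus_linear: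
  fixes y :: real
  assumes "0 \<le> y"
  shows "\<bar>exp (- y) - (1 - y)\<bar> \<le> y\<^sup>2"
proof -
  have "exp (- y) \<le> 1 / (1 + y)"
    using exp_ge_add_one_self[of y] assms by (simp add: exp_minus field_simps)
  also have "\<dots> \<le> 1 - y + y\<^sup>2"
  proof -
    have "1 \<le> 1 + y ^ 3" using assms by simp
    also have "\<dots> = (1 - y + y\<^sup>2) * (1 + y)" by algebra
    finally show ?thesis using assms by (simp add: divide_le_eq)
  qed
  finally show ?thesis using exp_ge_add_one_self[of "- y"] by simp
qed

lemma exp_minus_lipschitz:
  fixes u v :: real
  assumes "0 \<le> u" "0 \<le> v"
  shows "\<bar>exp (- u) - exp (- v)\<bar> \<le> \<bar>u - v\<bar>"
proof -
  have *: "exp (- a) - exp (- b) \<le> b - a" if "0 \<le> a" "a \<le> b" for a b :: real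
  proof -
    have "exp (- a) - exp (- b) = exp (- a) * (1 - exp (- (b - a)))"
      by (simp add: algebra_simps flip: exp_add)
    also have "\<dots> \<le> 1 * (b - a)"
    proof (rule mult_mono)
      show "1 - exp (- (b - a)) \<le> b - a" using exp_ge_add_one_self[of "- (b - a)"] by linarith
    qed (use that in auto)
    finally show ?thesis by simp
  qed
  show ?thesis
    using *[of u v] *[of v u] assms by (cases "u \<le> v") (auto simp: abs_if)
qed

lemma sum_lessThan_real: "(\<Sum>l<i. real l) = real i * (real i - 1) / 2"
  by (induction i) (auto simp: field_simps)

text \<open>
Dividing the miss probability by its independent counterpart \<open>q ^ i\<close> leaves a damping factor in which every
term is at most \<open>1\<close>. Truncating the terms at \<open>0\<close> changes nothing, because a negative term occurs only after one that
vanishes: \<open>q * N\<close> is the integer \<open>N - m\<close>.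
\<close>

lemma miss_tilted:
  assumes m: "m < N" and i: "i \<le> N" and p: "p = real m / real N" and q: "q = 1 - p"
  shows "miss N m i = q ^ i * (\<Prod>l<i. max 0 (1 - real l * p / (q * real (N - l))))"
proof -
  have N0: "0 < real N" and q0: "0 < q" using m by (auto simp: p q field_simps)
  have mN: "q * real N = real N - real m" using N0 by (simp add: p q field_simps)
  have fac: "1 - real m / real (N - l) = q * (1 - real l * p / (q * real (N - l)))" if "l < i" for l
  proof -
    have "l < N" using that i by simp
    then have pos: "0 < real (N - l)" and e: "real (N - l) = real N - real l" by (auto simp: of_nat_diff)
    have "q * (1 - real l * p / (q * real (N - l))) = q - real l * p / real (N - l)"
      using q0 pos by (simp add: field_simps)
    also have "\<dots> = (q * real N - (q + p) * real l) / real (N - l)"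
      using pos by (simp add: e field_simps)
    also have "\<dots> = 1 - real m / real (N - l)"
      using pos unfolding mN by (simp add: q e field_simps)
    finally show ?thesis by simp
  qed
  have "miss N m i = (\<Prod>l<i. 1 - real m / real (N - l))"
    using miss_prod i m by simp
  also have "\<dots> = (\<Prod>l<i. q * max 0 (1 - real l * p / (q * real (N - l))))"
  proof (cases "i \<le> N - m")
    case True
    show ?thesis
    proof (rule prod.cong[OF refl])
      fix l assume l: "l \<in> {..<i}"
      then have "0 \<le> 1 - real m / real (N - l)" using True i m by (auto simp: field_simps)
      then have "0 \<le> q * (1 - real l * p / (q * real (N - l)))"
        using fac[of l] l by simp
      then have "0 \<le> 1 - real l * p / (q * real (N - l))"
        using q0 by (simp only: zero_le_mult_iff) linarith
      then show "1 - real m / real (N - l) = q * max 0 (1 - real l * p / (q * real (N - l)))"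
        using fac[of l] l by simp
    qed
  next
    case False
    then have l: "N - m \<in> {..<i}" by simp
    have "m \<noteq> 0" using False i by auto
    then have z: "1 - real m / real (N - (N - m)) = 0" using m by simp
    then have z': "q * max 0 (1 - real (N - m) * p / (q * real (N - (N - m)))) = 0"
      using fac[of "N - m"] l q0 by (metis lessThan_iff max.idem mult_eq_0_iff less_irrefl)
    have "(\<Prod>l<i. 1 - real m / real (N - l)) = 0"
      using z l by (intro prod_zero) blast+
    moreover have "(\<Prod>l<i. q * max 0 (1 - real l * p / (q * real (N - l)))) = 0"
      using z' l by (intro prod_zero) blast+
    ultimately show ?thesis by (simp only:)
  qed
  also have "\<dots> = q ^ i * (\<Prod>l<i. max 0 (1 - real l * p / (q * real (N - l))))"
    by (simp add: prod.distrib)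
  finally show ?thesis .
qed

text \<open>
Each term \<open>1 - l p / (q (N - l))\<close> is compared with \<open>exp (- l p / (q N))\<close>; two products of numbers in
\<open>[0, 1]\<close> differ by at most the sum of the differences of their factors. The error keeps the factor \<open>i (i - 1)\<close>, whose mean for
a binomial \<open>i\<close> with parameter \<open>q / (1 + q)\<close> is at most \<open>k\<^sup>2 q\<^sup>2\<close>; this cancels the denominator and makes the
estimate uniform in \<open>q\<close>.
\<close>

lemma damping_factor_approx:
  assumes m: "m < N" and ik: "i \<le> k" and k: "2 * k \<le> N" and p: "p = real m / real N" and q: "q = 1 - p"
  shows "\<bar>(\<Prod>l<i. max 0 (1 - real l * p / (q * real (N - l)))) -
      exp (- (p / (2 * q * real N) * (real i * (real i - 1))))\<bar> \<le>
    3 * real k / (2 * q\<^sup>2 * (real N)\<^sup>2) * (real i * (real i - 1))"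
proof -
  have N0: "0 < real N" and q0: "0 < q" and p0: "0 \<le> p" and p1: "p \<le> 1" and q1: "q \<le> 1"
    using m by (auto simp: p q field_simps)
  define x where "x l = real l * p / (q * real (N - l))" for l
  define y where "y l = real l * p / (q * real N)" for l
  have x0: "0 \<le> x l" and y0: "0 \<le> y l" for l
    using q0 p0 N0 by (auto simp: x_def y_def)
  have "(\<Sum>l<i. y l) = (\<Sum>l<i. real l) * (p / (q * real N))"
    unfolding y_def sum_distrib_right by simp
  also have "\<dots> = p / (2 * q * real N) * (real i * (real i - 1))"
    unfolding sum_lessThan_real by (simp add: mult_ac)
  finally have sy: "(\<Prod>l<i. exp (- y l)) = exp (- (p / (2 * q * real N) * (real i * (real i - 1))))"
    by (simp add: sum_negf flip: exp_sum)
  have each: "\<bar>max 0 (1 - x l) - exp (- y l)\<bar> \<le> 3 * real k / (q\<^sup>2 * (real N)\<^sup>2) * real l" if "l < i" for l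
  proof -
    have l: "l \<le> k" "2 * l \<le> N" "l < N" using that ik k by auto
    then have Nl: "real N / 2 \<le> real (N - l)" "0 < real (N - l)" by (auto simp: of_nat_diff)
    have "x l - y l = real l * p / q * (1 / real (N - l) - 1 / real N)"
      by (simp add: x_def y_def right_diff_distrib)
    also have "1 / real (N - l) - 1 / real N = real l / (real (N - l) * real N)"
      using Nl(2) N0 l by (simp add: field_simps of_nat_diff)
    also have "real l * p / q * (real l / (real (N - l) * real N)) \<le> real l * 1 / q * (real l / ((real N / 2) * real N))"
      using p1 p0 q0 Nl N0 by (intro mult_mono divide_left_mono divide_right_mono) auto
    also have "\<dots> = 2 * (real l)\<^sup>2 / (q * (real N)\<^sup>2)" by (simp add: power2_eq_square)
    also have "\<dots> \<le> 2 * (real l)\<^sup>2 / (q\<^sup>2 * (real N)\<^sup>2)"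
      using q0 q1 N0 by (intro divide_left_mono mult_right_mono) (auto simp: power2_eq_square mult_left_le)
    finally have xy: "x l - y l \<le> 2 * (real l)\<^sup>2 / (q\<^sup>2 * (real N)\<^sup>2)" .
    have xy0: "y l \<le> x l"
      unfolding x_def y_def using q0 p0 Nl N0 by (intro divide_left_mono mult_left_mono) auto
    have "(y l)\<^sup>2 = p\<^sup>2 * ((real l)\<^sup>2 / (q\<^sup>2 * (real N)\<^sup>2))"
      by (simp add: y_def power_mult_distrib power_divide)
    also have "\<dots> \<le> 1 * ((real l)\<^sup>2 / (q\<^sup>2 * (real N)\<^sup>2))"
      using p0 p1 by (intro mult_right_mono) (auto simp: power_le_one)
    finally have yy: "(y l)\<^sup>2 \<le> (real l)\<^sup>2 / (q\<^sup>2 * (real N)\<^sup>2)" by simp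
    have "\<bar>max 0 (1 - x l) - exp (- y l)\<bar> \<le> \<bar>(1 - x l) - exp (- y l)\<bar>"
      by (auto simp: max_def abs_if)
    also have "\<dots> \<le> (x l - y l) + (y l)\<^sup>2"
      using exp_minus_linear[OF y0, of l] xy0 by linarith
    also have "\<dots> \<le> 2 * (real l)\<^sup>2 / (q\<^sup>2 * (real N)\<^sup>2) + (real l)\<^sup>2 / (q\<^sup>2 * (real N)\<^sup>2)"
      using xy yy by linarith
    also have "\<dots> = 3 * real l * real l / (q\<^sup>2 * (real N)\<^sup>2)"
      by (simp add: power2_eq_square)
    also have "\<dots> \<le> 3 * real k * real l / (q\<^sup>2 * (real N)\<^sup>2)"
      using l by (intro divide_right_mono mult_right_mono mult_left_mono) auto
    finally show ?thesis by simp
  qed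
  have "\<bar>(\<Prod>l<i. max 0 (1 - x l)) - (\<Prod>l<i. exp (- y l))\<bar> \<le> (\<Sum>l<i. \<bar>max 0 (1 - x l) - exp (- y l)\<bar>)"
    using norm_prod_diff[of "{..<i}" "\<lambda>l. max 0 (1 - x l)" "\<lambda>l. exp (- y l)"] x0 y0 by auto
  also have "\<dots> \<le> (\<Sum>l<i. 3 * real k / (q\<^sup>2 * (real N)\<^sup>2) * real l)"
    using each by (intro sum_mono) auto
  also have "\<dots> = 3 * real k / (2 * q\<^sup>2 * (real N)\<^sup>2) * (real i * (real i - 1))"
    unfolding sum_distrib_left[symmetric] sum_lessThan_real by simp
  finally show ?thesis unfolding sy by (simp only: x_def)
qed

lemma Bernstein_mean:
  "(\<Sum>i\<le>k. Bernstein k i r * real i) = real k * r"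
  "(\<Sum>i\<le>k. Bernstein k i r * (real i * (real i - 1))) = real k * (real k - 1) * r\<^sup>2"
  using sum_k_Bernstein[of k r] sum_kk_Bernstein[of k r] by (simp_all add: mult_ac)

text \<open>
Concentration of \<open>i (i - 1)\<close> for a binomial \<open>i\<close> with mean \<open>\<mu> = k r\<close>, using first and second moments only. The factor
\<open>r\<close> on the right is needed to divide by \<open>q\<close> later.
\<close>

lemma Bernstein_expectation_square_dev:
  assumes r: "0 \<le> r" "r \<le> 1" and k: "1 \<le> k"
  shows "(\<Sum>i\<le>k. Bernstein k i r * \<bar>real i * (real i - 1) - (real k * r)\<^sup>2\<bar>) \<le> 4 * r * (real k * sqrt (real k))"
proof -
  define \<mu> where "\<mu> = real k * r"
  define s where "s = sqrt (real k)"
  have s1: "1 \<le> s" and ss: "s * s = real k" using k by (auto simp: s_def)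
  have \<mu>0: "0 \<le> \<mu>" using r by (simp add: \<mu>_def)
  \<comment> \<open>The weight \<open>s\<close> balances the standard deviation, of order \<open>sqrt k\<close>, against the size \<open>k\<close> of \<open>i + \<mu>\<close>.\<close>
  have pt: "\<bar>real i * (real i - 1) - \<mu>\<^sup>2\<bar> \<le>
      (s * (real i - \<mu>)\<^sup>2 + (real i + \<mu>)\<^sup>2 / s) / 2 + real i" for i
  proof -
    have "\<bar>real i * (real i - 1) - \<mu>\<^sup>2\<bar> = \<bar>(real i - \<mu>) * (real i + \<mu>) - real i\<bar>"
      by (simp add: power2_eq_square algebra_simps)
    also have "\<dots> \<le> \<bar>real i - \<mu>\<bar> * (real i + \<mu>) + real i"
      using \<mu>0 by (intro order.trans[OF abs_triangle_ineq4]) (simp add: abs_mult)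
    also have "\<bar>real i - \<mu>\<bar> * (real i + \<mu>) \<le> (s * (real i - \<mu>)\<^sup>2 + (real i + \<mu>)\<^sup>2 / s) / 2"
    proof -
      have "0 \<le> (s * \<bar>real i - \<mu>\<bar> - (real i + \<mu>))\<^sup>2 / s" using s1 by simp
      also have "\<dots> = s * \<bar>real i - \<mu>\<bar>\<^sup>2 + (real i + \<mu>)\<^sup>2 / s - 2 * (\<bar>real i - \<mu>\<bar> * (real i + \<mu>))"
        using s1 by (simp add: field_simps power2_eq_square)
      finally show ?thesis by simp
    qed
    finally show ?thesis by simp
  qed
  let ?E = "\<lambda>f. \<Sum>i\<le>k. Bernstein k i r * f i"
  have Eadd: "?E (\<lambda>i. a * (real i * (real i - 1)) + b * real i + c) =
      a * (real k * (real k - 1) * r\<^sup>2) + b * (real k * r) + c" for a b c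
  proof -
    have "?E (\<lambda>i. a * (real i * (real i - 1)) + b * real i + c) =
      a * ?E (\<lambda>i. real i * (real i - 1)) + b * ?E real + c * (\<Sum>i\<le>k. Bernstein k i r)"
    proof -
      have "Bernstein k i r * (a * (real i * (real i - 1)) + b * real i + c) =
        a * (Bernstein k i r * (real i * (real i - 1))) + b * (Bernstein k i r * real i) + c * Bernstein k i r" for i
        by algebra
      then show ?thesis by (simp only: sum.distrib sum_distrib_left)
    qed
    then show ?thesis by (simp only: Bernstein_mean sum_Bernstein mult_1_right)
  qed
  have "?E (\<lambda>i. \<bar>real i * (real i - 1) - \<mu>\<^sup>2\<bar>) \<le> ?E (\<lambda>i. (s * (real i - \<mu>)\<^sup>2 + (real i + \<mu>)\<^sup>2 / s) / 2 + real i)"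
    by (intro sum_mono mult_left_mono pt Bernstein_nonneg r)
  also have "\<dots> = ?E (\<lambda>i. (s / 2 + 1 / (2 * s)) * (real i * (real i - 1)) +
      (s * (1 - 2 * \<mu>) / 2 + (1 + 2 * \<mu>) / (2 * s) + 1) * real i + (s * \<mu>\<^sup>2 / 2 + \<mu>\<^sup>2 / (2 * s)))"
    using s1 by (intro sum.cong refl arg_cong2[where f = "(*)"]) (simp add: field_simps power2_eq_square)
  also have "\<dots> = s / 2 * (real k * r * (1 - r)) + (1 / (2 * s)) * (4 * (real k * r)\<^sup>2 + real k * r * (1 - r)) + real k * r"
    unfolding Eadd \<mu>_def using s1 by (simp add: field_simps power2_eq_square)
  also have "\<dots> \<le> s / 2 * (real k * r) + (1 / (2 * s)) * (4 * (real k * r)\<^sup>2 + real k * r) + real k * r"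
    using r s1 by (intro add_mono mult_left_mono) (auto intro!: mult_left_le simp: mult_nonneg_nonneg)
  also have "\<dots> \<le> 4 * r * (real k * s)"
  proof -
    have a: "(1 / (2 * s)) * (4 * (real k * r)\<^sup>2 + real k * r) = 2 * (r * r) * (real k * s) + r * s / 2"
      unfolding ss[symmetric] using s1 by (simp add: field_simps power2_eq_square)
    have b: "r * r * (real k * s) \<le> r * (real k * s)"
      using r s1 by (intro mult_right_mono) (auto intro: mult_left_le)
    have "s * 1 \<le> s * real k" using k s1 by (intro mult_left_mono) auto
    then have c: "r * s \<le> r * (real k * s)"
      using r by (intro mult_left_mono) (auto simp: mult.commute)
    have "real k * 1 \<le> real k * s" using s1 by (intro mult_left_mono) auto
    then have d: "real k * r \<le> r * (real k * s)"
      using r mult_left_mono[of "real k" "real k * s" r] by (simp add: mult.commute)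
    show ?thesis unfolding a using b c d by (simp add: algebra_simps)
  qed
  finally show ?thesis by (simp only: \<mu>_def s_def)
qed

text \<open>
Expanding \<open>(1 - p / 2) ^ k\<close> as \<open>2 ^ - k\<close> times the binomial sum of \<open>(1 + q) ^ k\<close>, the quotient becomes the mean of the damping
factor at a binomial variable with parameters \<open>k\<close> and \<open>r = q / (1 + q)\<close>. That variable concentrates at \<open>k r\<close>, where
the damping factor is close to the exponential in the statement. The bound is uniform in \<open>p\<close>, including densities
tending to \<open>1\<close>.
\<close>

lemma one_way_avoidance_approx:
  assumes m: "m \<le> N" and k1: "1 \<le> k" and k: "2 * k \<le> N" and p: "p = real m / real N"
  defines "t \<equiv> real k * sqrt (real k) / real N"
  shows "\<bar>one_way_avoidance N m k / (1 - p / 2) ^ k -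
     exp (- ((real k)\<^sup>2 / (2 * real N) * (p * (1 - p) / (2 - p)\<^sup>2)))\<bar> \<le> 2 * t + 3 / 2 * t\<^sup>2"
proof -
  have t0: "0 \<le> t" by (simp add: t_def)
  have N0: "0 < real N" using k k1 by simp
  show ?thesis
  proof (cases "m = N")
    case True
    then have p1: "p = 1" using N0 by (simp add: p)
    have "(\<Sum>i\<le>k. real (k choose i) * miss N m i) = (\<Sum>i\<le>k. if i = 0 then 1 else 0)"
      using True k by (intro sum.cong) (auto simp: miss_one miss_0)
    then have "one_way_avoidance N m k = 1 / 2 ^ k" by (simp add: one_way_avoidance_def)
    then have Q1: "one_way_avoidance N m k / (1 - p / 2) ^ k = 1"
      by (simp add: p1 power_divide)
    show ?thesis unfolding Q1 using t0 by (simp add: p1)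
  next
    case False
    then have mN: "m < N" using m by simp
    define q where "q = 1 - p"
    have q0: "0 < q" and p0: "0 \<le> p" and p1: "p \<le> 1" and q1: "q \<le> 1"
      using mN by (auto simp: p q_def field_simps)
    define r where "r = q / (1 + q)"
    have r0: "0 \<le> r" and r1: "r \<le> 1" and rq: "r \<le> q"
      using q0 by (auto simp: r_def field_simps)
    define \<phi> where "\<phi> i = (\<Prod>l<i. max 0 (1 - real l * p / (q * real (N - l))))" for i
    define S where "S i = p / (2 * q * real N) * (real i * (real i - 1))" for i
    define c where "c = p / (2 * q * real N) * (real k * r)\<^sup>2"
    have ii: "0 \<le> real i * (real i - 1)" for i by (cases i) auto
    have c_eq: "c = (real k)\<^sup>2 / (2 * real N) * (p * (1 - p) / (2 - p)\<^sup>2)"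
    proof -
      have "2 - p = 1 + q" "1 - p = q" by (auto simp: q_def)
      then show ?thesis unfolding c_def r_def \<open>2 - p = 1 + q\<close> \<open>1 - p = q\<close>
        using q0 N0 by (simp add: field_simps power2_eq_square)
    qed
    have "one_way_avoidance N m k / (1 - p / 2) ^ k = (\<Sum>i\<le>k. real (k choose i) * miss N m i) / (1 + q) ^ k"
    proof -
      have "1 + q = 2 * (1 - p / 2)" by (simp add: q_def)
      then have "(1 + q) ^ k = 2 ^ k * (1 - p / 2) ^ k" by (simp only: power_mult_distrib)
      then show ?thesis by (simp add: one_way_avoidance_def)
    qed
    also have "\<dots> = (\<Sum>i\<le>k. Bernstein k i r * \<phi> i)"
      unfolding sum_divide_distrib
    proof (rule sum.cong[OF refl])
      fix i assume i: "i \<in> {..k}"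
      have "1 - r = 1 / (1 + q)" using q0 by (simp add: r_def field_simps)
      then have "r ^ i * (1 - r) ^ (k - i) = q ^ i / ((1 + q) ^ i * (1 + q) ^ (k - i))"
        by (simp add: r_def power_divide)
      also have "(1 + q) ^ i * (1 + q) ^ (k - i) = (1 + q) ^ k"
        using i by (simp flip: power_add)
      finally have B: "Bernstein k i r = real (k choose i) * (q ^ i / (1 + q) ^ k)"
        by (simp add: Bernstein_def mult.assoc)
      have "miss N m i = q ^ i * \<phi> i"
        unfolding \<phi>_def using miss_tilted[OF mN _ p q_def, of i] i k by simp
      then show "real (k choose i) * miss N m i / (1 + q) ^ k = Bernstein k i r * \<phi> i"
        unfolding B by simp
    qed
    finally have Q: "one_way_avoidance N m k / (1 - p / 2) ^ k = (\<Sum>i\<le>k. Bernstein k i r * \<phi> i)" .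
    have pt: "\<bar>\<phi> i - exp (- c)\<bar> \<le> 3 * real k / (2 * q\<^sup>2 * (real N)\<^sup>2) * (real i * (real i - 1)) +
        p / (2 * q * real N) * \<bar>real i * (real i - 1) - (real k * r)\<^sup>2\<bar>" if i: "i \<le> k" for i
    proof -
      have "\<bar>\<phi> i - exp (- S i)\<bar> \<le> 3 * real k / (2 * q\<^sup>2 * (real N)\<^sup>2) * (real i * (real i - 1))"
        unfolding \<phi>_def S_def by (rule damping_factor_approx[OF mN i k p q_def])
      moreover have "\<bar>exp (- S i) - exp (- c)\<bar> \<le> \<bar>S i - c\<bar>"
        by (rule exp_minus_lipschitz) (use p0 q0 ii in \<open>auto simp: S_def c_def\<close>)
      moreover have "\<bar>S i - c\<bar> = p / (2 * q * real N) * \<bar>real i * (real i - 1) - (real k * r)\<^sup>2\<bar>"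
      proof -
        have "S i - c = p / (2 * q * real N) * (real i * (real i - 1) - (real k * r)\<^sup>2)"
          by (simp only: S_def c_def right_diff_distrib)
        then show ?thesis using p0 q0 by (simp add: abs_mult)
      qed
      ultimately show ?thesis by linarith
    qed
    have "(\<Sum>i\<le>k. Bernstein k i r * \<phi> i) - exp (- c) = (\<Sum>i\<le>k. Bernstein k i r * (\<phi> i - exp (- c)))"
      by (simp add: right_diff_distrib sum_subtractf flip: sum_distrib_right)
    also have "\<bar>\<dots>\<bar> \<le> (\<Sum>i\<le>k. Bernstein k i r * \<bar>\<phi> i - exp (- c)\<bar>)"
      using Bernstein_nonneg[OF r0 r1] by (intro order.trans[OF sum_abs]) (auto simp: abs_mult)
    also have "\<dots> \<le> (\<Sum>i\<le>k. Bernstein k i r * (3 * real k / (2 * q\<^sup>2 * (real N)\<^sup>2) * (real i * (real i - 1)) +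
        p / (2 * q * real N) * \<bar>real i * (real i - 1) - (real k * r)\<^sup>2\<bar>))"
      by (intro sum_mono mult_left_mono pt Bernstein_nonneg r0 r1) auto
    also have "\<dots> = 3 * real k / (2 * q\<^sup>2 * (real N)\<^sup>2) * (\<Sum>i\<le>k. Bernstein k i r * (real i * (real i - 1))) +
        p / (2 * q * real N) * (\<Sum>i\<le>k. Bernstein k i r * \<bar>real i * (real i - 1) - (real k * r)\<^sup>2\<bar>)"
    proof -
      have "a * (b * c + d * e) = b * (a * c) + d * (a * e)" for a b c d e :: real by algebra
      then show ?thesis by (simp only: sum.distrib sum_distrib_left)
    qed
    also have "\<dots> \<le> 3 * real k / (2 * q\<^sup>2 * (real N)\<^sup>2) * (real k * real k * q\<^sup>2) +
        1 / (2 * q * real N) * (4 * q * (real k * sqrt (real k)))"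
    proof (rule add_mono; rule mult_mono)
      show "(\<Sum>i\<le>k. Bernstein k i r * (real i * (real i - 1))) \<le> real k * real k * q\<^sup>2"
        unfolding Bernstein_mean using r0 rq k1 by (intro mult_mono power_mono) auto
      show "0 \<le> (\<Sum>i\<le>k. Bernstein k i r * (real i * (real i - 1)))"
        unfolding Bernstein_mean using k1 by simp
      have "4 * r * (real k * sqrt (real k)) \<le> 4 * q * (real k * sqrt (real k))"
        using rq by (intro mult_right_mono) auto
      then show "(\<Sum>i\<le>k. Bernstein k i r * \<bar>real i * (real i - 1) - (real k * r)\<^sup>2\<bar>) \<le> 4 * q * (real k * sqrt (real k))"
        using Bernstein_expectation_square_dev[OF r0 r1 k1] by linarith
    qed (use q0 p0 p1 N0 r0 r1 ii in \<open>auto intro!: sum_nonneg mult_nonneg_nonneg divide_right_mono Bernstein_nonneg\<close>)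
    also have "\<dots> = 2 * t + 3 / 2 * t\<^sup>2"
    proof -
      have "t\<^sup>2 = (real k * real k) * (sqrt (real k) * sqrt (real k)) / (real N)\<^sup>2"
        by (simp add: t_def power2_eq_square)
      then have "t\<^sup>2 = (real k * real k) * real k / (real N)\<^sup>2" by simp
      moreover have "3 * real k / (2 * q\<^sup>2 * (real N)\<^sup>2) * (real k * real k * q\<^sup>2) = 3 / 2 * ((real k * real k) * real k / (real N)\<^sup>2)"
        using q0 by simp
      ultimately have "3 * real k / (2 * q\<^sup>2 * (real N)\<^sup>2) * (real k * real k * q\<^sup>2) = 3 / 2 * t\<^sup>2"
        by simp
      moreover have "1 / (2 * q * real N) * (4 * q * (real k * sqrt (real k))) = 2 * t"
        using q0 by (simp add: t_def)
      ultimately show ?thesis by linarith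
    qed
    finally show ?thesis unfolding Q c_eq .
  qed
qed

section \<open>Colourings and two-coloured pairs\<close>

definition split_pairs :: "'v set \<Rightarrow> ('v \<Rightarrow> 'k) \<Rightarrow> 'v set set" where
  "split_pairs W c = {{u, v} |u v. u \<in> W \<and> v \<in> W \<and> c u \<noteq> c v}"

text \<open>
Vertices of \<open>W\<close> are coloured freely by \<open>K\<close>; the other vertices keep their prescribed colours. Writing this as a dependent
product makes \<open>prod_sum_PiE\<close> applicable.
\<close>

definition colourings :: "'v set \<Rightarrow> 'v set \<Rightarrow> ('v \<Rightarrow> 'k) \<Rightarrow> 'k set \<Rightarrow> ('v \<Rightarrow> 'k) set" where
  "colourings V W \<gamma> K = (\<Pi>\<^sub>E v\<in>V. if v \<in> W then K else {\<gamma> v})"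

definition monochrome :: "'v set \<Rightarrow> ('v \<Rightarrow> 'k) \<Rightarrow> bool" where
  "monochrome W c \<longleftrightarrow> (\<forall>u\<in>W. \<forall>v\<in>W. c u = c v)"

definition constant_colouring :: "'v set \<Rightarrow> 'v set \<Rightarrow> ('v \<Rightarrow> 'k) \<Rightarrow> 'k \<Rightarrow> 'v \<Rightarrow> 'k" where
  "constant_colouring V W \<gamma> \<kappa> = restrict (\<lambda>v. if v \<in> W then \<kappa> else \<gamma> v) V"

lemma constant_colouring_in: "\<kappa> \<in> K \<Longrightarrow> constant_colouring V W \<gamma> \<kappa> \<in> colourings V W \<gamma> K"
  by (auto simp: colourings_def constant_colouring_def)

lemma finite_colourings: "finite V \<Longrightarrow> finite K \<Longrightarrow> finite (colourings V W \<gamma> K)"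
  unfolding colourings_def by (intro finite_PiE) auto

lemma colouring_free: "c \<in> colourings V W \<gamma> K \<Longrightarrow> v \<in> V \<Longrightarrow> v \<in> W \<Longrightarrow> c v \<in> K"
  unfolding colourings_def by (auto dest!: PiE_mem)

lemma colouring_fixed: "c \<in> colourings V W \<gamma> K \<Longrightarrow> v \<in> V \<Longrightarrow> v \<notin> W \<Longrightarrow> c v = \<gamma> v"
  unfolding colourings_def by (auto dest!: PiE_mem)

lemma monochrome_colourings:
  assumes "W \<subseteq> V" "K \<noteq> {}"
  shows "{c \<in> colourings V W \<gamma> K. monochrome W c} \<subseteq> constant_colouring V W \<gamma> ` K"
proof
  fix c assume c: "c \<in> {c \<in> colourings V W \<gamma> K. monochrome W c}"
  obtain \<kappa> where \<kappa>: "\<kappa> \<in> K" "\<forall>w\<in>W. c w = \<kappa>"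
  proof (cases "W = {}")
    case True
    then show ?thesis using assms(2) that by auto
  next
    case False
    then obtain w where "w \<in> W" by blast
    show ?thesis
    proof (rule that)
      show "c w \<in> K" using c assms(1) \<open>w \<in> W\<close> colouring_free[of c V W \<gamma> K w] by blast
      show "\<forall>u\<in>W. c u = c w" using c \<open>w \<in> W\<close> unfolding monochrome_def by blast
    qed
  qed
  have "c = constant_colouring V W \<gamma> \<kappa>"
  proof
    fix v
    show "c v = constant_colouring V W \<gamma> \<kappa> v"
    proof (cases "v \<in> V")
      case True
      then show ?thesis
        using c \<kappa>(2) colouring_fixed[of c V W \<gamma> K v] by (simp add: constant_colouring_def)
    next
      case False
      then have "c v = undefined" using c unfolding colourings_def by (auto intro: PiE_arb)
      then show ?thesis using False by (simp add: constant_colouring_def)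
    qed
  qed
  then show "c \<in> constant_colouring V W \<gamma> ` K" using \<kappa>(1) by blast
qed

lemma inj_on_doubleton: "X \<inter> Y = {} \<Longrightarrow> inj_on (\<lambda>(u, v). {u, v}) (X \<times> Y)"
  by (auto simp: inj_on_def doubleton_eq_iff)

lemma split_pairs_subset: "split_pairs W c \<subseteq> Pow W"
  by (auto simp: split_pairs_def)

lemma card_split_pairs_ge:
  assumes "finite W"
  shows "card {v \<in> W. c v = \<kappa>} * card {v \<in> W. c v \<noteq> \<kappa>} \<le> card (split_pairs W c)"
proof -
  let ?X = "{v \<in> W. c v = \<kappa>}" and ?Y = "{v \<in> W. c v \<noteq> \<kappa>}"
  have "card ?X * card ?Y = card ((\<lambda>(u, v). {u, v}) ` (?X \<times> ?Y))"
    by (subst card_image[OF inj_on_doubleton]) (auto simp: card_cartesian_product)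
  also have "\<dots> \<le> card (split_pairs W c)"
  proof (rule card_mono)
    show "finite (split_pairs W c)"
      using assms split_pairs_subset finite_subset by (metis finite_Pow_iff)
    show "(\<lambda>(u, v). {u, v}) ` (?X \<times> ?Y) \<subseteq> split_pairs W c"
      unfolding split_pairs_def by fastforce
  qed
  finally show ?thesis .
qed

lemma majority_colour:
  assumes "finite W" "finite K" "K \<noteq> {}" "c ` W \<subseteq> K"
  obtains \<kappa> where "\<kappa> \<in> K" "card W div card K \<le> card {v \<in> W. c v = \<kappa>}"
proof (rule ccontr)
  note thesis_rule = that
  assume no: "\<not> thesis"
  have lt: "card {v \<in> W. c v = \<kappa>} < card W div card K" if "\<kappa> \<in> K" for \<kappa>
    using no thesis_rule[OF that] by (meson linorder_not_less)
  have "card W = (\<Sum>\<kappa>\<in>K. card {v \<in> W. c v = \<kappa>})"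
    using sum.group[OF assms(1,2,4), of "\<lambda>_. 1 :: nat"] by simp
  also have "\<dots> < (\<Sum>\<kappa>\<in>K. card W div card K)"
    by (rule sum_strict_mono) (use assms lt in auto)
  also have "\<dots> \<le> card W" by simp
  finally show False by simp
qed

text \<open>
A partition function at low temperature is dominated by its ground states. If \<open>\<kappa>\<close> is a most frequent colour, every vertex with another
colour forms a two-coloured pair with each of the at least \<open>card W div card K\<close> vertices of colour \<open>\<kappa>\<close>. Summing over
\<open>\<kappa>\<close>, the remaining vertices become independent and the sum factorises.
\<close>

lemma potts_sum_bound:
  fixes x :: real
  assumes V: "finite V" "W \<subseteq> V" and K: "finite K" "K \<noteq> {}" and x: "0 \<le> x" "x \<le> 1"
  shows "(\<Sum>c\<in>{c \<in> colourings V W \<gamma> K. \<not> monochrome W c}. x ^ card (split_pairs W c)) \<le>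
    real (card K) * ((1 + real (card K - 1) * x ^ (card W div card K)) ^ card W - 1)"
proof -
  define Col where "Col = colourings V W \<gamma> K"
  define y where "y = x ^ (card W div card K)"
  have W: "finite W" using V finite_subset by blast
  have fin: "finite Col" unfolding Col_def using finite_colourings V K by blast
  have y0: "0 \<le> y" using x by (simp add: y_def)
  define P where "P \<kappa> c = (\<Prod>v\<in>W. if c v = \<kappa> then 1 else y)" for \<kappa> and c :: "'a \<Rightarrow> 'b"
  have P0: "0 \<le> P \<kappa> c" for \<kappa> c using y0 by (auto simp: P_def intro!: prod_nonneg)
  have "x ^ card (split_pairs W c) \<le> (\<Sum>\<kappa>\<in>K. P \<kappa> c)" if c: "c \<in> Col" for c
  proof -
    have "c ` W \<subseteq> K" using c V(2) colouring_free unfolding Col_def by fast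
    then obtain \<kappa> where \<kappa>: "\<kappa> \<in> K" "card W div card K \<le> card {v \<in> W. c v = \<kappa>}"
      using majority_colour[OF W K] by blast
    have "(card W div card K) * card {v \<in> W. c v \<noteq> \<kappa>} \<le> card (split_pairs W c)"
      using card_split_pairs_ge[OF W, of c \<kappa>] \<kappa>(2) mult_le_mono1 le_trans by blast
    then have "x ^ card (split_pairs W c) \<le> x ^ ((card W div card K) * card {v \<in> W. c v \<noteq> \<kappa>})"
      using x by (intro power_decreasing) auto
    also have "\<dots> = P \<kappa> c"
    proof -
      have "W \<inter> - {v. c v = \<kappa>} = {v \<in> W. c v \<noteq> \<kappa>}" by auto
      then show ?thesis using W by (simp add: P_def y_def power_mult prod.If_cases)
    qed
    also have "\<dots> \<le> (\<Sum>\<kappa>\<in>K. P \<kappa> c)"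
      using \<kappa>(1) K(1) P0 by (intro member_le_sum) auto
    finally show ?thesis .
  qed
  then have "(\<Sum>c\<in>{c \<in> Col. \<not> monochrome W c}. x ^ card (split_pairs W c)) \<le>
      (\<Sum>c\<in>{c \<in> Col. \<not> monochrome W c}. \<Sum>\<kappa>\<in>K. P \<kappa> c)"
    by (intro sum_mono) auto
  also have "\<dots> = (\<Sum>\<kappa>\<in>K. \<Sum>c\<in>{c \<in> Col. \<not> monochrome W c}. P \<kappa> c)"
    by (rule sum.swap)
  also have "\<dots> \<le> (\<Sum>\<kappa>\<in>K. (1 + real (card K - 1) * y) ^ card W - 1)"
  proof (rule sum_mono)
    fix \<kappa> assume \<kappa>: "\<kappa> \<in> K"
    let ?c = "constant_colouring V W \<gamma> \<kappa>"
    have cc: "?c \<in> Col" unfolding Col_def using \<kappa> by (rule constant_colouring_in)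
    have c\<kappa>: "?c v = \<kappa>" if "v \<in> W" for v using that V(2) by (auto simp: constant_colouring_def)
    have Pc: "P \<kappa> ?c = 1" using c\<kappa> by (simp add: P_def)
    have "monochrome W ?c" using c\<kappa> by (simp add: monochrome_def)
    then have "{c \<in> Col. \<not> monochrome W c} \<subseteq> Col - {?c}" by auto
    then have "(\<Sum>c\<in>{c \<in> Col. \<not> monochrome W c}. P \<kappa> c) \<le> (\<Sum>c\<in>Col - {?c}. P \<kappa> c)"
      using fin P0 by (intro sum_mono2) auto
    also have "\<dots> = (\<Sum>c\<in>Col. P \<kappa> c) - 1"
      using fin cc Pc by (simp add: sum_diff1)
    also have "(\<Sum>c\<in>Col. P \<kappa> c) =
        (\<Sum>c\<in>Col. \<Prod>v\<in>V. if v \<in> W then if c v = \<kappa> then 1 else y else 1)"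
      unfolding P_def using V by (simp add: prod.If_cases Int_absorb1)
    also have "\<dots> = (\<Prod>v\<in>V. \<Sum>k\<in>(if v \<in> W then K else {\<gamma> v}). if v \<in> W then if k = \<kappa> then 1 else y else 1)"
      unfolding Col_def colourings_def using V K by (intro prod_sum_PiE[symmetric]) auto
    also have "\<dots> = (\<Prod>v\<in>V. if v \<in> W then 1 + real (card K - 1) * y else 1)"
    proof (rule prod.cong[OF refl])
      fix v
      have "(\<Sum>k\<in>K. if k = \<kappa> then 1 else y) = 1 + (\<Sum>k\<in>K - {\<kappa>}. y)"
        using \<kappa> K(1) by (subst sum.remove[of K \<kappa>]) auto
      then show "(\<Sum>k\<in>(if v \<in> W then K else {\<gamma> v}). if v \<in> W then if k = \<kappa> then 1 else y else 1) =
          (if v \<in> W then 1 + real (card K - 1) * y else 1)"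
        using \<kappa> K(1) by simp
    qed
    also have "\<dots> = (1 + real (card K - 1) * y) ^ card W"
      using V by (simp add: prod.If_cases Int_absorb1)
    finally show "(\<Sum>c\<in>{c \<in> Col. \<not> monochrome W c}. P \<kappa> c) \<le> (1 + real (card K - 1) * y) ^ card W - 1" .
  qed
  finally show ?thesis by (simp add: Col_def y_def)
qed

lemma potts_sum_total:
  fixes x :: real
  assumes V: "finite V" "W \<subseteq> V" and K: "finite K" "K \<noteq> {}" and x: "0 \<le> x" "x \<le> 1"
  shows "(\<Sum>c\<in>colourings V W \<gamma> K. x ^ card (split_pairs W c)) \<le>
    real (card K) * (1 + real (card K - 1) * x ^ (card W div card K)) ^ card W"
proof -
  let ?Col = "colourings V W \<gamma> K"
  have fin: "finite ?Col" using finite_colourings V K by blast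
  have "(\<Sum>c\<in>?Col. x ^ card (split_pairs W c)) =
     (\<Sum>c\<in>{c \<in> ?Col. monochrome W c}. x ^ card (split_pairs W c)) +
     (\<Sum>c\<in>{c \<in> ?Col. \<not> monochrome W c}. x ^ card (split_pairs W c))"
    by (subst sum.union_disjoint[symmetric]) (auto simp: fin intro!: sum.cong)
  moreover have "(\<Sum>c\<in>{c \<in> ?Col. monochrome W c}. x ^ card (split_pairs W c)) \<le> real (card K)"
  proof -
    have "(\<Sum>c\<in>{c \<in> ?Col. monochrome W c}. x ^ card (split_pairs W c)) \<le>
        (\<Sum>c\<in>{c \<in> ?Col. monochrome W c}. 1)"
      using x by (intro sum_mono) (auto simp: power_le_one)
    also have "\<dots> = real (card {c \<in> ?Col. monochrome W c})" by simp
    also have "card {c \<in> ?Col. monochrome W c} \<le> card (constant_colouring V W \<gamma> ` K)"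
      using K(1) monochrome_colourings[OF V(2) K(2)] by (intro card_mono) auto
    also have "\<dots> \<le> card K" using K(1) by (rule card_image_le)
    finally show ?thesis by simp
  qed
  ultimately show ?thesis
    using potts_sum_bound[OF assms, of \<gamma>] by (simp add: algebra_simps)
qed

lemma prod_subset_le:
  fixes f :: "'a \<Rightarrow> real"
  assumes "finite A" "B \<subseteq> A" "\<And>a. a \<in> A \<Longrightarrow> 0 \<le> f a" "\<And>a. a \<in> A \<Longrightarrow> f a \<le> 1"
  shows "prod f A \<le> prod f B"
proof -
  have "prod f A = prod f (A - B) * prod f B"
    by (rule prod.subset_diff) (use assms in auto)
  also have "\<dots> \<le> 1 * prod f B"
    by (intro mult_right_mono prod_le_1 prod_nonneg) (use assms in auto)
  finally show ?thesis by simp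
qed

text \<open>
In the product bound for avoidance it suffices to keep the edges between \<open>W\<close> and the roots \<open>X\<close>, grouped by their
endpoint in \<open>W\<close>, and the two-coloured pairs within \<open>W\<close>.
\<close>

lemma prob_avoid_colouring:
  assumes m: "m \<le> n choose 2" and p: "p = real m / real (n choose 2)"
    and WX: "W \<union> X \<subseteq> {1..n}" "W \<inter> X = {}"
    and h: "\<And>v. v \<in> W \<Longrightarrow> (\<Prod>u\<in>X. 1 - p + p * edge_weight F {u, v}) \<le> h"
    and x: "\<And>u v. u \<in> W \<Longrightarrow> v \<in> W \<Longrightarrow> c u \<noteq> c v \<Longrightarrow> 1 - p + p * edge_weight F {u, v} \<le> x"
  shows "measure_pmf.prob (directed_Gnm n m) (avoid F) \<le> h ^ card W * x ^ card (split_pairs W c)"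
proof -
  define f where "f e = 1 - p + p * edge_weight F e" for e
  have p01: "0 \<le> p" "p \<le> 1" using m by (auto simp: p divide_le_eq_1)
  have f01: "0 \<le> f e" "f e \<le> 1" for e
    using p01 edge_weight_bounds[of F e] mult_left_le[of "edge_weight F e" p]
      mult_nonneg_nonneg[of p "edge_weight F e"] by (auto simp: f_def)
  define cross where "cross = (\<lambda>(u, v). {u, v}) ` (X \<times> W)"
  have fin: "finite W" "finite X" using WX finite_subset by auto
  have fS: "finite (split_pairs W c)"
    using fin split_pairs_subset finite_subset by (metis finite_Pow_iff)
  have "measure_pmf.prob (directed_Gnm n m) (avoid F) \<le> prod f (all_edges n)"
    unfolding f_def by (rule prob_avoid_le[OF m p])
  also have "\<dots> \<le> prod f (cross \<union> split_pairs W c)"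
  proof (rule prod_subset_le[OF finite_all_edges _ f01])
    show "cross \<union> split_pairs W c \<subseteq> all_edges n"
      using WX unfolding cross_def split_pairs_def all_edges_def
      by (auto simp: card_2_iff doubleton_eq_iff; blast)
  qed
  also have "\<dots> = prod f cross * prod f (split_pairs W c)"
    using fin fS WX(2) split_pairs_subset[of W c]
    by (intro prod.union_disjoint) (auto simp: cross_def)
  also have "\<dots> \<le> h ^ card W * x ^ card (split_pairs W c)"
  proof (rule mult_mono)
    have "prod f cross = (\<Prod>(u, v)\<in>X \<times> W. f {u, v})"
      unfolding cross_def using WX(2)
      by (subst prod.reindex[OF inj_on_doubleton]) (auto simp: case_prod_unfold)
    also have "\<dots> = (\<Prod>v\<in>W. \<Prod>u\<in>X. f {u, v})"
      by (subst prod.swap) (simp add: prod.cartesian_product)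
    also have "\<dots> \<le> (\<Prod>v\<in>W. h)"
      using h f01 by (intro prod_mono) (auto simp: f_def intro!: prod_nonneg)
    finally show "prod f cross \<le> h ^ card W" by simp
    have "prod f (split_pairs W c) \<le> (\<Prod>e\<in>split_pairs W c. x)"
      using x f01 unfolding split_pairs_def by (intro prod_mono) (auto simp: f_def)
    then show "prod f (split_pairs W c) \<le> x ^ card (split_pairs W c)" by simp
    have "0 \<le> h" if "v \<in> W" for v
      using h[OF that] f01 prod_nonneg[of X "\<lambda>u. f {u, v}"] unfolding f_def by fastforce
    then show "0 \<le> h ^ card W" by (cases "W = {}") auto
    show "0 \<le> prod f (split_pairs W c)" using f01 by (auto intro!: prod_nonneg)
  qed
  finally show ?thesis .
qed

section \<open>Chains of closed sets\<close>

lemma edge_weight_antimono: "F \<subseteq> G \<Longrightarrow> edge_weight G e \<le> edge_weight F e"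
  unfolding edge_weight_def by (auto simp: of_bool_def)

definition upward_arcs :: "nat \<Rightarrow> (nat \<Rightarrow> nat) \<Rightarrow> (nat \<times> nat) set" where
  "upward_arcs n c = {(u, v). u \<in> {1..n} \<and> v \<in> {1..n} \<and> c u < c v}"

lemma edge_weight_upward_arcs:
  assumes "u \<in> {1..n}" "v \<in> {1..n}" "u \<noteq> v"
  shows "edge_weight (upward_arcs n c) {u, v} = (if c u = c v then 1 else 1 / 2)"
  using assms by (auto simp: edge_weight_pair upward_arcs_def)

text \<open>
A chain of \<open>r - 1\<close> closed sets separating the roots \<open>\<rho> 0, \<dots>, \<rho> (r - 1)\<close> in this order is encoded by the level of
each vertex: the \<open>i\<close>-th set consists of the vertices of level at most \<open>i\<close>.
\<close>

locale rooted_layers =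
  fixes n r :: nat and \<rho> :: "nat \<Rightarrow> nat"
  assumes inj: "inj_on \<rho> {..<r}" and roots: "\<rho> ` {..<r} \<subseteq> {1..n}" and r_pos: "0 < r"
begin

definition free :: "nat set" where
  "free = {1..n} - \<rho> ` {..<r}"

definition level :: "nat \<Rightarrow> nat" where
  "level = inv_into {..<r} \<rho>"

definition layerings :: "(nat \<Rightarrow> nat) set" where
  "layerings = colourings {1..n} free level {..<r}"

text \<open>
The event that sets left by no arc separate the roots in the order of their indices.
\<close>

definition layer_event :: "(nat \<times> nat) set set" where
  "layer_event = (\<Union>c\<in>layerings. avoid (upward_arcs n c))"

text \<open>
The layering in which all free vertices share the level \<open>\<kappa>\<close>, so that all other levels contain a root only.
\<close>

definition flat :: "nat \<Rightarrow> nat \<Rightarrow> nat" where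
  "flat = constant_colouring {1..n} free level"

lemma level_root: "i < r \<Longrightarrow> level (\<rho> i) = i"
  using inj by (simp add: level_def)

lemma card_roots: "card (\<rho> ` {..<r}) = r"
  using card_image[OF inj] by simp

lemma card_free: "card free = n - r"
  unfolding free_def using roots card_roots by (subst card_Diff_subset) auto

lemma layering_root: "c \<in> layerings \<Longrightarrow> i < r \<Longrightarrow> c (\<rho> i) = i"
  using colouring_fixed[of c "{1..n}" free level "{..<r}" "\<rho> i"] roots level_root[of i]
  by (auto simp: layerings_def free_def)

lemma layering_less: "c \<in> layerings \<Longrightarrow> v \<in> free \<Longrightarrow> c v < r"
  using colouring_free[of c "{1..n}" free level "{..<r}" v]
  by (auto simp: layerings_def free_def)

lemma flat_layering: "\<kappa> < r \<Longrightarrow> flat \<kappa> \<in> layerings"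
  unfolding flat_def layerings_def by (rule constant_colouring_in) simp

lemma flat_free: "v \<in> free \<Longrightarrow> flat \<kappa> v = \<kappa>"
  by (auto simp: flat_def constant_colouring_def free_def)

lemma finite_layerings: "finite layerings"
  unfolding layerings_def by (intro finite_colourings) auto

lemma layer_eventI:
  assumes "\<And>i. i < r \<Longrightarrow> c (\<rho> i) = i" "\<And>v. v \<in> {1..n} \<Longrightarrow> c v < r" "D \<inter> upward_arcs n c = {}"
  shows "D \<in> layer_event"
proof -
  have "restrict c {1..n} \<in> layerings"
    unfolding layerings_def colourings_def
    using assms(1,2) level_root roots by (auto simp: free_def)
  moreover have "upward_arcs n (restrict c {1..n}) = upward_arcs n c"
    by (auto simp: upward_arcs_def)
  ultimately show ?thesis
    unfolding layer_event_def avoid_def using assms(3) by auto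
qed

lemma split_pairs_flat:
  assumes "\<kappa> < r"
  shows "card (split_pairs {1..n} (flat \<kappa>)) = (r - 1) * (n - r) + (r choose 2)"
proof -
  let ?X = "\<rho> ` {..<r}" and ?c = "flat \<kappa>"
  let ?cross = "(\<lambda>(u, v). {u, v}) ` ((?X - {\<rho> \<kappa>}) \<times> free)" and ?P = "{e. e \<subseteq> ?X \<and> card e = 2}"
  have V: "{1..n} = ?X \<union> free" and dis: "?X \<inter> free = {}" using roots by (auto simp: free_def)
  have fin: "finite free" by (simp add: free_def)
  have cX: "?c (\<rho> i) = i" if "i < r" for i using layering_root[OF flat_layering[OF assms] that] .
  have root_ne: "?c u \<noteq> \<kappa>" if "u \<in> ?X - {\<rho> \<kappa>}" for u
    using that cX by auto
  have "split_pairs {1..n} ?c = ?cross \<union> ?P"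
  proof
    show "split_pairs {1..n} ?c \<subseteq> ?cross \<union> ?P"
    proof
      fix e assume "e \<in> split_pairs {1..n} ?c"
      then obtain u v where e: "e = {u, v}" "u \<in> ?X \<union> free" "v \<in> ?X \<union> free" "?c u \<noteq> ?c v"
        unfolding split_pairs_def V by blast
      have cross: "{x, y} \<in> ?cross" if "x \<in> ?X" "y \<in> free" "?c x \<noteq> ?c y" for x y
      proof -
        have "x \<noteq> \<rho> \<kappa>" using that cX[OF assms] flat_free by auto
        then show ?thesis using that by force
      qed
      consider "u \<in> ?X" "v \<in> ?X" | "u \<in> ?X" "v \<in> free" | "u \<in> free" "v \<in> ?X" | "u \<in> free" "v \<in> free"
        using e by blast
      then show "e \<in> ?cross \<union> ?P"
      proof cases
        case 1
        then have "e \<in> ?P" using e(1,4) by (cases "u = v") auto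
        then show ?thesis by blast
      next
        case 2
        then show ?thesis using cross e by simp
      next
        case 3
        then have "{v, u} \<in> ?cross" using cross e(4) by metis
        then show ?thesis using e(1) by (simp add: insert_commute)
      next
        case 4
        then show ?thesis using e flat_free by simp
      qed
    qed
    show "?cross \<union> ?P \<subseteq> split_pairs {1..n} ?c"
    proof
      fix e assume "e \<in> ?cross \<union> ?P"
      then consider u v where "e = {u, v}" "u \<in> ?X - {\<rho> \<kappa>}" "v \<in> free"
        | i j where "e = {\<rho> i, \<rho> j}" "i < r" "j < r" "\<rho> i \<noteq> \<rho> j"
        by (auto simp: card_2_iff)
      then show "e \<in> split_pairs {1..n} ?c"
      proof cases
        case 1
        then have "?c u \<noteq> ?c v" using root_ne flat_free by simp
        then show ?thesis using 1 unfolding split_pairs_def V by blast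
      next
        case 2
        then have "?c (\<rho> i) \<noteq> ?c (\<rho> j)" using cX by metis
        then show ?thesis using 2 unfolding split_pairs_def V by blast
      qed
    qed
  qed
  moreover have "?cross \<inter> ?P = {}" using dis by auto
  moreover have "card ?cross = (r - 1) * (n - r)"
  proof -
    have "card ?cross = card ((?X - {\<rho> \<kappa>}) \<times> free)"
      by (rule card_image, rule inj_on_doubleton) (use dis in auto)
    moreover have "card (?X - {\<rho> \<kappa>}) = r - 1"
      using assms by (subst card_Diff_singleton) (auto simp: card_roots)
    ultimately show ?thesis by (simp add: card_cartesian_product card_free)
  qed
  moreover have "card ?P = r choose 2"
    by (subst n_subsets) (auto simp: card_roots)
  moreover have "finite ?cross" "finite ?P"
    using fin by (auto intro: finite_subset[of _ "Pow ?X"])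
  ultimately show ?thesis by (simp add: card_Un_disjoint)
qed

definition base_pairs :: nat where
  "base_pairs = (r - 1) * (n - r) + (r choose 2)"

lemma prob_flat:
  assumes "m \<le> n choose 2" "\<kappa> < r"
  shows "measure_pmf.prob (directed_Gnm n m) (avoid (upward_arcs n (flat \<kappa>))) =
    one_way_avoidance (n choose 2) m base_pairs"
proof -
  have "measure_pmf.prob (directed_Gnm n m) (avoid (upward_arcs n (flat \<kappa>))) =
    one_way_avoidance (n choose 2) m (card (split_pairs {1..n} (flat \<kappa>)))"
  proof (rule prob_avoid_one_way[OF assms(1)])
    show "split_pairs {1..n} (flat \<kappa>) \<subseteq> all_edges n"
      unfolding split_pairs_def all_edges_def by (auto simp: card_2_iff)
    fix e assume "e \<in> all_edges n"
    then obtain u v where uv: "u \<in> {1..n}" "v \<in> {1..n}" "u \<noteq> v" "e = {u, v}"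
      by (rule all_edges_elim)
    have "e \<in> split_pairs {1..n} (flat \<kappa>) \<longleftrightarrow> flat \<kappa> u \<noteq> flat \<kappa> v"
      unfolding split_pairs_def using uv by (auto simp: doubleton_eq_iff)
    then show "edge_weight (upward_arcs n (flat \<kappa>)) e = (if e \<in> split_pairs {1..n} (flat \<kappa>) then 1 / 2 else 1)"
      using uv by (simp add: edge_weight_upward_arcs)
  qed
  then show ?thesis by (simp only: split_pairs_flat[OF assms(2)] base_pairs_def)
qed

lemma prob_layering_le:
  assumes m: "m \<le> n choose 2" and p: "p = real m / real (n choose 2)" and c: "c \<in> layerings"
  shows "measure_pmf.prob (directed_Gnm n m) (avoid (upward_arcs n c)) \<le>
    ((1 - p / 2) ^ (r - 1)) ^ (n - r) * (1 - p / 2) ^ card (split_pairs free c)"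
proof -
  have V: "free \<union> \<rho> ` {..<r} \<subseteq> {1..n}" and dis: "free \<inter> \<rho> ` {..<r} = {}"
    using roots by (auto simp: free_def)
  have "measure_pmf.prob (directed_Gnm n m) (avoid (upward_arcs n c)) \<le>
    ((1 - p / 2) ^ (r - 1)) ^ card free * (1 - p / 2) ^ card (split_pairs free c)"
  proof (rule prob_avoid_colouring[OF m p V dis])
    fix v assume v: "v \<in> free"
    have e: "1 - p + p * edge_weight (upward_arcs n c) {\<rho> i, v} = (if i = c v then 1 else 1 - p / 2)"
      if i: "i < r" for i
    proof -
      have "\<rho> i \<noteq> v" using dis v i by auto
      moreover have "\<rho> i \<in> {1..n}" "v \<in> {1..n}" using V v i by auto
      ultimately show ?thesis
        using layering_root[OF c i] by (simp add: edge_weight_upward_arcs)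
    qed
    have "(\<Prod>u\<in>\<rho> ` {..<r}. 1 - p + p * edge_weight (upward_arcs n c) {u, v}) =
        (\<Prod>i<r. 1 - p + p * edge_weight (upward_arcs n c) {\<rho> i, v})"
      using prod.reindex[OF inj] by simp
    also have "\<dots> = (\<Prod>i<r. if i = c v then 1 else 1 - p / 2)"
      using e by (intro prod.cong) auto
    also have "\<dots> = (\<Prod>i\<in>{..<r} - {c v}. 1 - p / 2)"
      using layering_less[OF c v] by (subst prod.remove[of _ "c v"]) auto
    also have "\<dots> = (1 - p / 2) ^ (r - 1)"
      using layering_less[OF c v] by simp
    finally show "(\<Prod>u\<in>\<rho> ` {..<r}. 1 - p + p * edge_weight (upward_arcs n c) {u, v}) \<le> (1 - p / 2) ^ (r - 1)"
      by simp
  next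
    fix u v assume "u \<in> free" "v \<in> free" "c u \<noteq> c v"
    moreover from this have "u \<noteq> v" by auto
    ultimately show "1 - p + p * edge_weight (upward_arcs n c) {u, v} \<le> 1 - p / 2"
      using V by (subst edge_weight_upward_arcs) auto
  qed
  then show ?thesis by (simp add: card_free)
qed

text \<open>
A free vertex at level \<open>\<kappa>\<close> has a constrained edge to every root except \<open>\<rho> \<kappa>\<close>; two different flat layerings together
constrain its edges to all \<open>r\<close> roots. The additional factor per free vertex makes double counting negligible.
\<close>

lemma prob_two_flat_le:
  assumes m: "m \<le> n choose 2" and p: "p = real m / real (n choose 2)"
    and \<kappa>: "\<kappa> < r" "\<kappa>' < r" "\<kappa> \<noteq> \<kappa>'"
  shows "measure_pmf.prob (directed_Gnm n m)
      (avoid (upward_arcs n (flat \<kappa>)) \<inter> avoid (upward_arcs n (flat \<kappa>'))) \<le>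
    ((1 - p / 2) ^ r) ^ (n - r)"
proof -
  have p01: "0 \<le> p" "p \<le> 1" using m by (auto simp: p divide_le_eq_1)
  let ?F = "upward_arcs n (flat \<kappa>)" and ?G = "upward_arcs n (flat \<kappa>')"
  have V: "free \<union> \<rho> ` {..<r} \<subseteq> {1..n}" and dis: "free \<inter> \<rho> ` {..<r} = {}"
    using roots by (auto simp: free_def)
  have "avoid ?F \<inter> avoid ?G = avoid (?F \<union> ?G)" by (auto simp: avoid_def)
  also have "measure_pmf.prob (directed_Gnm n m) (avoid (?F \<union> ?G)) \<le>
    ((1 - p / 2) ^ r) ^ card free * (1 - p / 2) ^ card (split_pairs free (\<lambda>_. ()))"
  proof (rule prob_avoid_colouring[OF m p V dis])
    fix v assume v: "v \<in> free"
    have "(\<Prod>u\<in>\<rho> ` {..<r}. 1 - p + p * edge_weight (?F \<union> ?G) {u, v}) =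
        (\<Prod>i<r. 1 - p + p * edge_weight (?F \<union> ?G) {\<rho> i, v})"
      using prod.reindex[OF inj] by simp
    also have "\<dots> \<le> (\<Prod>i<r. 1 - p / 2)"
    proof (rule prod_mono)
      fix i assume i: "i \<in> {..<r}"
      have 1: "\<rho> i \<in> {1..n}" "v \<in> {1..n}" "\<rho> i \<noteq> v" using V dis v i by auto
      have "edge_weight ?F {\<rho> i, v} = (if i = \<kappa> then 1 else 1 / 2)"
           "edge_weight ?G {\<rho> i, v} = (if i = \<kappa>' then 1 else 1 / 2)"
        using layering_root[OF flat_layering] i \<kappa> flat_free[OF v]
        by (simp_all add: edge_weight_upward_arcs[OF 1])
      then have "edge_weight (?F \<union> ?G) {\<rho> i, v} \<le> 1 / 2"
        using \<kappa>(3) edge_weight_antimono[of ?F "?F \<union> ?G" "{\<rho> i, v}"]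
          edge_weight_antimono[of ?G "?F \<union> ?G" "{\<rho> i, v}"] by (cases "i = \<kappa>") auto
      then have "p * edge_weight (?F \<union> ?G) {\<rho> i, v} \<le> p * (1 / 2)"
        using p01 by (intro mult_left_mono)
      moreover have "0 \<le> p * edge_weight (?F \<union> ?G) {\<rho> i, v}"
        using p01 by (simp add: edge_weight_bounds)
      ultimately show "0 \<le> 1 - p + p * edge_weight (?F \<union> ?G) {\<rho> i, v} \<and>
          1 - p + p * edge_weight (?F \<union> ?G) {\<rho> i, v} \<le> 1 - p / 2"
        using p01 by simp
    qed
    finally show "(\<Prod>u\<in>\<rho> ` {..<r}. 1 - p + p * edge_weight (?F \<union> ?G) {u, v}) \<le> (1 - p / 2) ^ r"
      by simp
  qed simp
  finally show ?thesis by (simp add: card_free split_pairs_def)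
qed

text \<open>
Union bound over layerings, split into the flat ones, which give the main term, and those counted by
\<open>potts_sum_bound\<close>. Every free vertex has \<open>r - 1\<close> constrained edges to roots, whatever its level.
\<close>

lemma layer_event_upper:
  assumes m: "m \<le> n choose 2" and p: "p = real m / real (n choose 2)"
  shows "measure_pmf.prob (directed_Gnm n m) layer_event \<le>
    real r * one_way_avoidance (n choose 2) m base_pairs +
    (1 - p / 2) ^ ((r - 1) * (n - r)) *
      (real r * ((1 + real (r - 1) * (1 - p / 2) ^ ((n - r) div r)) ^ (n - r) - 1))"
proof -
  let ?P = "measure_pmf.prob (directed_Gnm n m)" and ?A = "\<lambda>c. avoid (upward_arcs n c)"
  let ?x = "1 - p / 2"
  have x: "0 \<le> ?x" "?x \<le> 1" using m by (auto simp: p divide_le_eq_1)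
  let ?flat = "{c \<in> layerings. monochrome free c}" and ?rest = "{c \<in> layerings. \<not> monochrome free c}"
  have "?P layer_event \<le> (\<Sum>c\<in>layerings. ?P (?A c))"
    unfolding layer_event_def
    by (rule measure_pmf.finite_measure_subadditive_finite[OF finite_layerings]) auto
  also have "\<dots> = (\<Sum>c\<in>?flat. ?P (?A c)) + (\<Sum>c\<in>?rest. ?P (?A c))"
    by (subst sum.union_disjoint[symmetric]) (auto simp: finite_layerings intro!: sum.cong)
  also have "(\<Sum>c\<in>?flat. ?P (?A c)) \<le> real r * one_way_avoidance (n choose 2) m base_pairs"
  proof -
    have "?flat \<subseteq> flat ` {..<r}"
      unfolding layerings_def flat_def by (rule monochrome_colourings) (use r_pos in \<open>auto simp: free_def\<close>)
    then have "(\<Sum>c\<in>?flat. ?P (?A c)) \<le> (\<Sum>c\<in>flat ` {..<r}. ?P (?A c))"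
      by (intro sum_mono2) auto
    also have "\<dots> \<le> (\<Sum>\<kappa><r. ?P (?A (flat \<kappa>)))"
      using sum_image_le[of "{..<r}" "\<lambda>c. ?P (?A c)" flat] by (simp add: o_def)
    also have "\<dots> = (\<Sum>\<kappa><r. one_way_avoidance (n choose 2) m base_pairs)"
      by (rule sum.cong) (auto simp: prob_flat[OF m])
    finally show ?thesis by simp
  qed
  also have "(\<Sum>c\<in>?rest. ?P (?A c)) \<le>
      (\<Sum>c\<in>?rest. (?x ^ (r - 1)) ^ (n - r) * ?x ^ card (split_pairs free c))"
    by (intro sum_mono prob_layering_le[OF m p]) auto
  also have "\<dots> = ?x ^ ((r - 1) * (n - r)) * (\<Sum>c\<in>?rest. ?x ^ card (split_pairs free c))"
    by (simp add: sum_distrib_left power_mult)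
  also have "\<dots> \<le> ?x ^ ((r - 1) * (n - r)) *
      (real r * ((1 + real (r - 1) * ?x ^ ((n - r) div r)) ^ (n - r) - 1))"
  proof (rule mult_left_mono)
    have "free \<subseteq> {1..n}" "{..<r} \<noteq> {}" using r_pos by (auto simp: free_def)
    then show "(\<Sum>c\<in>?rest. ?x ^ card (split_pairs free c)) \<le>
        real r * ((1 + real (r - 1) * ?x ^ ((n - r) div r)) ^ (n - r) - 1)"
      using potts_sum_bound[of "{1..n}" free "{..<r}" ?x level] x
      by (simp add: layerings_def card_free)
  qed (use x in simp)
  finally show ?thesis by simp
qed

end

lemma (in prob_space) bonferroni_lower:
  fixes A :: "nat \<Rightarrow> 'a set"
  assumes "\<And>i. A i \<in> events"
  shows "(\<Sum>i<r. prob (A i)) - (\<Sum>i<r. \<Sum>j<i. prob (A j \<inter> A i)) \<le> prob (\<Union>i<r. A i)"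
proof (induction r)
  case (Suc r)
  let ?U = "\<Union>i<r. A i"
  have U: "?U \<in> events" using assms by auto
  have "prob (?U \<inter> A r) = prob (\<Union>j<r. A j \<inter> A r)" by (rule arg_cong[where f = prob]) auto
  also have "\<dots> \<le> (\<Sum>j<r. prob (A j \<inter> A r))"
    by (rule finite_measure_subadditive_finite) (use assms in auto)
  finally have "prob (?U \<inter> A r) \<le> (\<Sum>j<r. prob (A j \<inter> A r))" .
  moreover have "prob (?U \<union> A r) = prob ?U + prob (A r) - prob (?U \<inter> A r)"
    using measure_Un3[OF fmeasurable_eq_sets[THEN equalityD2, THEN subsetD] fmeasurable_eq_sets[THEN equalityD2, THEN subsetD], OF U assms]
    by simp
  moreover have "(\<Union>i<Suc r. A i) = ?U \<union> A r" by (auto simp: less_Suc_eq)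
  ultimately show ?case using Suc by simp
qed simp

context rooted_layers
begin

text \<open>
The flat layerings alone, with a Bonferroni correction for their overlaps.
\<close>

lemma layer_event_lower:
  assumes m: "m \<le> n choose 2" and p: "p = real m / real (n choose 2)"
  shows "real r * one_way_avoidance (n choose 2) m base_pairs -
      (real r)\<^sup>2 * (1 - p / 2) ^ (r * (n - r)) \<le>
    measure_pmf.prob (directed_Gnm n m) layer_event"
proof -
  let ?P = "measure_pmf.prob (directed_Gnm n m)"
  let ?x = "1 - p / 2"
  define A where "A \<kappa> = avoid (upward_arcs n (flat \<kappa>))" for \<kappa>
  have x: "0 \<le> ?x" "?x \<le> 1" using m by (auto simp: p divide_le_eq_1)
  have "(\<Sum>\<kappa><r. \<Sum>j<\<kappa>. ?P (A j \<inter> A \<kappa>)) \<le> (\<Sum>\<kappa><r. \<Sum>j<\<kappa>. (?x ^ r) ^ (n - r))"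
    unfolding A_def by (intro sum_mono prob_two_flat_le[OF m p]) auto
  also have "\<dots> \<le> (\<Sum>\<kappa><r. real r * (?x ^ r) ^ (n - r))"
    using x by (intro sum_mono) (auto intro!: mult_right_mono)
  also have "\<dots> = (real r)\<^sup>2 * ?x ^ (r * (n - r))"
    by (simp add: power2_eq_square power_mult)
  finally have pairs: "(\<Sum>\<kappa><r. \<Sum>j<\<kappa>. ?P (A j \<inter> A \<kappa>)) \<le> (real r)\<^sup>2 * ?x ^ (r * (n - r))" .
  have "(\<Sum>\<kappa><r. ?P (A \<kappa>)) = (\<Sum>\<kappa><r. one_way_avoidance (n choose 2) m base_pairs)"
    unfolding A_def by (rule sum.cong) (auto simp: prob_flat[OF m])
  then have "real r * one_way_avoidance (n choose 2) m base_pairs - (real r)\<^sup>2 * ?x ^ (r * (n - r)) \<le>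
      (\<Sum>\<kappa><r. ?P (A \<kappa>)) - (\<Sum>\<kappa><r. \<Sum>j<\<kappa>. ?P (A j \<inter> A \<kappa>))"
    using pairs by simp
  also have "\<dots> \<le> ?P (\<Union>\<kappa><r. A \<kappa>)"
    by (rule measure_pmf.bonferroni_lower) auto
  also have "\<dots> \<le> ?P layer_event"
    unfolding layer_event_def A_def using flat_layering
    by (intro measure_pmf.finite_measure_mono) auto
  finally show ?thesis .
qed

end

section \<open>Unreachability and closed sets\<close>

text \<open>
The witness is the set of vertices reachable from \<open>s\<close>. Paths have distinct vertices, so when an arc leads back to a vertex
on the path, the path is cut off there.
\<close>

lemma no_path_iff_closed:
  assumes D: "D \<subseteq> V \<times> V" and s: "s \<in> V"
  shows "D \<in> no_path s a \<longleftrightarrow> (\<exists>S\<subseteq>V. s \<in> S \<and> a \<notin> S \<and> D \<inter> (S \<times> (V - S)) = {})"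
proof
  assume np: "D \<in> no_path s a"
  define S where "S = {v \<in> V. \<exists>xs. dipath D s xs v}"
  have "dipath D s [s] s" by (simp add: dipath_def)
  then have "s \<in> S" using s by (auto simp: S_def)
  moreover have "a \<notin> S" using np by (auto simp: S_def no_path_def)
  moreover have "D \<inter> (S \<times> (V - S)) = {}"
  proof (rule ccontr)
    assume "D \<inter> (S \<times> (V - S)) \<noteq> {}"
    then obtain v w where vw: "(v, w) \<in> D" "v \<in> S" "w \<in> V" "w \<notin> S" by auto
    then obtain xs where xs: "dipath D s xs v" by (auto simp: S_def)
    have "\<exists>ys. dipath D s ys w"
    proof (cases "w \<in> set xs")
      case True
      then obtain ys zs where eq: "xs = (ys @ [w]) @ zs" by (auto dest: split_list)
      then have "successively (\<lambda>x y. (x, y) \<in> D) (ys @ [w])"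
        using xs unfolding dipath_def by (metis successively_append_iff)
      moreover have "hd (ys @ [w]) = s" "distinct (ys @ [w])"
        using xs eq by (cases ys; auto simp: dipath_def)+
      ultimately have "dipath D s (ys @ [w]) w" by (simp add: dipath_def)
      then show ?thesis by blast
    next
      case False
      then have "dipath D s (xs @ [w]) w"
        using xs vw(1) by (auto simp: dipath_def successively_append_iff)
      then show ?thesis by blast
    qed
    then show False using vw(3,4) by (auto simp: S_def)
  qed
  moreover have "S \<subseteq> V" by (auto simp: S_def)
  ultimately show "\<exists>S\<subseteq>V. s \<in> S \<and> a \<notin> S \<and> D \<inter> (S \<times> (V - S)) = {}" by blast
next
  assume "\<exists>S\<subseteq>V. s \<in> S \<and> a \<notin> S \<and> D \<inter> (S \<times> (V - S)) = {}"
  then obtain S where S: "s \<in> S" "a \<notin> S" "D \<inter> (S \<times> (V - S)) = {}" by blast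
  have step: "v \<in> S" if "u \<in> S" "(u, v) \<in> D" for u v
    using S(3) D that by blast
  have "last xs \<in> S" if "xs \<noteq> []" "hd xs \<in> S" "successively (\<lambda>x y. (x, y) \<in> D) xs" for xs
    using that
  proof (induction xs rule: induct_list012)
    case (3 x y zs)
    then show ?case using step by auto
  qed auto
  then show "D \<in> no_path s a" using S unfolding no_path_def dipath_def by blast
qed

lemma oriented_graphs_arcs: "D \<in> oriented_graphs n m \<Longrightarrow> D \<subseteq> {1..n} \<times> {1..n}"
  by (simp add: oriented_graphs_def)

lemma prob_mono_oriented:
  assumes "m \<le> n choose 2" "\<And>D. D \<subseteq> {1..n} \<times> {1..n} \<Longrightarrow> D \<in> X \<Longrightarrow> D \<in> Y"
  shows "measure_pmf.prob (directed_Gnm n m) X \<le> measure_pmf.prob (directed_Gnm n m) Y"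
proof (rule prob_relabel_le[OF assms(1), of id])
  fix D assume "D \<in> oriented_graphs n m" "D \<in> X"
  then show "map_prod id id ` D \<in> Y"
    using assms(2)[OF oriented_graphs_arcs] by (simp add: prod.map_id0)
qed simp

lemma no_path_relabel:
  assumes f: "bij_betw f V V" and D: "D \<subseteq> V \<times> V" and "s \<in> V" "a \<in> V" "D \<in> no_path s a"
  shows "map_prod f f ` D \<in> no_path (f s) (f a)"
proof -
  have inj: "inj_on f V" and img: "f ` V = V" using f by (auto simp: bij_betw_def)
  obtain S where S: "S \<subseteq> V" "s \<in> S" "a \<notin> S" "D \<inter> (S \<times> (V - S)) = {}"
    using assms(5) no_path_iff_closed[OF D assms(3)] by blast
  have mem: "f v \<in> f ` S \<longleftrightarrow> v \<in> S" if "v \<in> V" for v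
    using inj S(1) that by (auto simp: inj_on_def)
  have "map_prod f f ` D \<inter> (f ` S \<times> (V - f ` S)) = {}"
  proof -
    have False if uv: "(u, v) \<in> D" "f x = f u" "x \<in> S" "f v \<notin> f ` S" for u v x
    proof -
      have "u \<in> V" "v \<in> V" "f u \<in> f ` S" using D uv by (auto intro: image_eqI[of _ _ x])
      then have "u \<in> S" "v \<in> V - S" using mem uv by auto
      then show False using S(4) uv(1) by blast
    qed
    then show ?thesis by auto
  qed
  moreover have "f a \<notin> f ` S" using mem assms(4) S(3) by blast
  moreover have "f ` S \<subseteq> V" "f s \<in> f ` S" using S img by auto
  moreover have "map_prod f f ` D \<subseteq> V \<times> V"
  proof -
    have "map_prod f f ` D \<subseteq> map_prod f f ` (V \<times> V)" using D by (rule image_mono)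
    also have "\<dots> = V \<times> V" by (rule map_prod_surj_on[OF img img])
    finally show ?thesis .
  qed
  moreover have "f s \<in> V" using assms(3) img by blast
  ultimately show ?thesis using no_path_iff_closed[of "map_prod f f ` D" V "f s" "f a"] by blast
qed

lemma relabelling_exists:
  assumes V: "finite V" and "s \<in> V" "a \<in> V" "b \<in> V" "s' \<in> V" "a' \<in> V" "b' \<in> V"
    and "s \<noteq> a" "s \<noteq> b" "a \<noteq> b" "s' \<noteq> a'" "s' \<noteq> b'" "a' \<noteq> b'"
  obtains f where "bij_betw f V V" "f s = s'" "f a = a'" "f b = b'"
proof -
  have "card (V - {s, a, b}) = card (V - {s', a', b'})"
  proof -
    have "card {s, a, b} = 3" "card {s', a', b'} = 3" using assms by auto
    moreover have "{s, a, b} \<subseteq> V" "{s', a', b'} \<subseteq> V" using assms by auto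
    ultimately show ?thesis by (simp add: card_Diff_subset)
  qed
  then obtain g where g: "bij_betw g (V - {s, a, b}) (V - {s', a', b'})"
    using finite_same_card_bij[of "V - {s, a, b}" "V - {s', a', b'}"] V by auto
  define f where "f v = (if v = s then s' else if v = a then a' else if v = b then b' else g v)" for v
  have "bij_betw f (V - {s, a, b}) (V - {s', a', b'})"
    using g by (rule bij_betw_cong[THEN iffD1, rotated]) (auto simp: f_def)
  moreover have "bij_betw f {s, a, b} {s', a', b'}"
    using assms by (auto simp: bij_betw_def inj_on_def f_def)
  ultimately have "bij_betw f ((V - {s, a, b}) \<union> {s, a, b}) ((V - {s', a', b'}) \<union> {s', a', b'})"
    by (rule bij_betw_combine) auto
  moreover have "(V - {s, a, b}) \<union> {s, a, b} = V" "(V - {s', a', b'}) \<union> {s', a', b'} = V"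
    using assms(2-7) by blast+
  ultimately have "bij_betw f V V" by simp
  moreover have "f s = s'" "f a = a'" "f b = b'" using assms by (auto simp: f_def)
  ultimately show ?thesis using that by blast
qed

lemma prob_no_path_symmetric:
  assumes m: "m \<le> n choose 2"
    and V: "s \<in> {1..n}" "a \<in> {1..n}" "b \<in> {1..n}" "s' \<in> {1..n}" "a' \<in> {1..n}" "b' \<in> {1..n}"
    and ne: "s \<noteq> a" "s \<noteq> b" "a \<noteq> b" "s' \<noteq> a'" "s' \<noteq> b'" "a' \<noteq> b'"
  shows "measure_pmf.prob (directed_Gnm n m) (no_path s a) = measure_pmf.prob (directed_Gnm n m) (no_path s' a')"
    and "measure_pmf.prob (directed_Gnm n m) (no_path s a \<inter> no_path b s) =
      measure_pmf.prob (directed_Gnm n m) (no_path s' a' \<inter> no_path b' s')"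
proof -
  let ?P = "measure_pmf.prob (directed_Gnm n m)"
  have le: "?P (no_path s a) \<le> ?P (no_path s' a') \<and>
      ?P (no_path s a \<inter> no_path b s) \<le> ?P (no_path s' a' \<inter> no_path b' s')"
    if V: "s \<in> {1..n}" "a \<in> {1..n}" "b \<in> {1..n}" "s' \<in> {1..n}" "a' \<in> {1..n}" "b' \<in> {1..n}"
      and ne: "s \<noteq> a" "s \<noteq> b" "a \<noteq> b" "s' \<noteq> a'" "s' \<noteq> b'" "a' \<noteq> b'" for s a b s' a' b'
  proof -
    obtain f where f: "bij_betw f {1..n} {1..n}" and fs: "f s = s'" "f a = a'" "f b = b'"
      using relabelling_exists[OF _ V ne] by blast
    have r: "map_prod f f ` D \<in> no_path (f u) (f v)"
      if "D \<in> oriented_graphs n m" "u \<in> {1..n}" "v \<in> {1..n}" "D \<in> no_path u v" for D u v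
      using no_path_relabel[OF f oriented_graphs_arcs[OF that(1)]] that by blast
    show ?thesis
      using r V by (intro conjI prob_relabel_le[OF m f]) (auto simp flip: fs)
  qed
  show "?P (no_path s a) = ?P (no_path s' a')"
    using le[OF V ne] le[OF V(4-6) V(1-3) ne(4-6) ne(1-3)] by simp
  show "?P (no_path s a \<inter> no_path b s) = ?P (no_path s' a' \<inter> no_path b' s')"
    using le[OF V ne] le[OF V(4-6) V(1-3) ne(4-6) ne(1-3)] by simp
qed

lemma prob_no_path_pair_symmetric:
  assumes m: "m \<le> n choose 2"
    and V: "s \<in> {1..n}" "a \<in> {1..n}" "b \<in> {1..n}" and ne: "s \<noteq> a" "s \<noteq> b" "a \<noteq> b"
  shows "measure_pmf.prob (directed_Gnm n m) (no_path b s) = measure_pmf.prob (directed_Gnm n m) (no_path s a)"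
  using prob_no_path_symmetric(1)[OF m V(3,1,2) V(1,2,3)] ne by auto

abbreviation two_roots :: "nat \<Rightarrow> nat \<Rightarrow> nat \<Rightarrow> nat" where
  "two_roots s a \<equiv> (\<lambda>i. if i = 0 then s else a)"

text \<open>
The order matters: a set closed under arcs that contains \<open>b\<close> but not \<open>s\<close> is the smaller one, and the set that
contains \<open>s\<close> but not \<open>a\<close> is the larger one.
\<close>

abbreviation three_roots :: "nat \<Rightarrow> nat \<Rightarrow> nat \<Rightarrow> nat \<Rightarrow> nat" where
  "three_roots b s a \<equiv> (\<lambda>i. if i = 0 then b else if i = 1 then s else a)"

lemma rooted_layers_2:
  "s \<in> {1..n} \<Longrightarrow> a \<in> {1..n} \<Longrightarrow> s \<noteq> a \<Longrightarrow> rooted_layers n 2 (two_roots s a)"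
  by unfold_locales (auto simp: inj_on_def)

lemma rooted_layers_3:
  "b \<in> {1..n} \<Longrightarrow> s \<in> {1..n} \<Longrightarrow> a \<in> {1..n} \<Longrightarrow> s \<noteq> a \<Longrightarrow> s \<noteq> b \<Longrightarrow> a \<noteq> b \<Longrightarrow>
    rooted_layers n 3 (three_roots b s a)"
  by unfold_locales (auto simp: inj_on_def)

lemma (in rooted_layers) layer_eventE:
  assumes "D \<in> layer_event"
  obtains c where "\<And>i. i < r \<Longrightarrow> c (\<rho> i) = i"
    "\<And>j. D \<inter> ({v \<in> {1..n}. c v \<le> j} \<times> ({1..n} - {v \<in> {1..n}. c v \<le> j})) = {}"
proof -
  obtain c where c: "c \<in> layerings" "D \<inter> upward_arcs n c = {}"
    using assms by (auto simp: layer_event_def avoid_def)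
  show ?thesis
  proof (rule that[of c])
    show "c (\<rho> i) = i" if "i < r" for i using layering_root[OF c(1) that] .
    show "D \<inter> ({v \<in> {1..n}. c v \<le> j} \<times> ({1..n} - {v \<in> {1..n}. c v \<le> j})) = {}" for j
      using c(2) by (auto simp: upward_arcs_def)
  qed
qed

lemma (in rooted_layers) layer_event_no_path:
  assumes D: "D \<subseteq> {1..n} \<times> {1..n}" "D \<in> layer_event" and ij: "i < j" "j < r"
  shows "D \<in> no_path (\<rho> i) (\<rho> j)"
proof -
  obtain c where c: "\<And>i. i < r \<Longrightarrow> c (\<rho> i) = i"
    "\<And>j. D \<inter> ({v \<in> {1..n}. c v \<le> j} \<times> ({1..n} - {v \<in> {1..n}. c v \<le> j})) = {}"
    by (rule layer_eventE[OF D(2)]) blast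
  let ?S = "{v \<in> {1..n}. c v \<le> i}"
  have "\<rho> i \<in> \<rho> ` {..<r}" using ij by simp
  then have root: "\<rho> i \<in> {1..n}" using roots by blast
  have "c (\<rho> i) = i" "c (\<rho> j) = j" using c(1) ij by simp_all
  then have "?S \<subseteq> {1..n} \<and> \<rho> i \<in> ?S \<and> \<rho> j \<notin> ?S" using root ij by auto
  then show ?thesis
    using no_path_iff_closed[OF D(1) root] c(2)[of i] by blast
qed

lemma prob_no_path_layers:
  assumes m: "m \<le> n choose 2" and V: "s \<in> {1..n}" "a \<in> {1..n}" "s \<noteq> a"
  shows "measure_pmf.prob (directed_Gnm n m) (no_path s a) =
    measure_pmf.prob (directed_Gnm n m) (rooted_layers.layer_event n 2 (two_roots s a))"
proof (rule antisym; rule prob_mono_oriented[OF m])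
  interpret rooted_layers n 2 "two_roots s a" by (rule rooted_layers_2[OF V])
  fix D assume D: "D \<subseteq> {1..n} \<times> {1..n}"
  {
    assume "D \<in> no_path s a"
    then obtain S where S: "S \<subseteq> {1..n}" "s \<in> S" "a \<notin> S" "D \<inter> (S \<times> ({1..n} - S)) = {}"
      using no_path_iff_closed[OF D V(1)] by blast
    show "D \<in> layer_event"
      by (rule layer_eventI[of "\<lambda>v. if v \<in> S then 0 else 1"])
         (use S in \<open>auto simp: upward_arcs_def split: if_splits\<close>)
  next
    assume "D \<in> layer_event"
    then show "D \<in> no_path s a"
      using layer_event_no_path[OF D, of 0 1] by simp
  }
qed

text \<open>
The configurations in which the two closed sets cannot be arranged as a chain.
\<close>

definition twin_event :: "nat \<Rightarrow> nat \<Rightarrow> nat \<Rightarrow> nat \<Rightarrow> (nat \<times> nat) set set" where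
  "twin_event n s a b = {D. \<exists>S U. S \<subseteq> {1..n} \<and> U \<subseteq> {1..n} \<and> s \<in> S - U \<and> a \<in> U - S \<and> b \<in> U - S \<and>
     D \<inter> (S \<times> ({1..n} - S)) = {} \<and> D \<inter> (U \<times> ({1..n} - U)) = {}}"

text \<open>
Closed sets are stable under union and intersection. If \<open>a \<notin> U\<close>, the chain is \<open>U \<subseteq> S \<union> U\<close>; if \<open>b \<in> S\<close>, it is
\<open>S \<inter> U \<subseteq> S\<close>.
\<close>

lemma joint_layers_or_twin:
  assumes D: "D \<subseteq> {1..n} \<times> {1..n}"
    and V: "s \<in> {1..n}" "a \<in> {1..n}" "b \<in> {1..n}" and ne: "s \<noteq> a" "s \<noteq> b" "a \<noteq> b"
    and np: "D \<in> no_path s a" "D \<in> no_path b s"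
  shows "D \<in> rooted_layers.layer_event n 3 (three_roots b s a) \<union> twin_event n s a b"
proof -
  interpret rooted_layers n 3 "three_roots b s a" by (rule rooted_layers_3) (use V ne in auto)
  have lay: "D \<in> layer_event" if "b \<in> T" "s \<in> R" "s \<notin> T" "a \<notin> R" "T \<subseteq> R"
    "D \<inter> (T \<times> ({1..n} - T)) = {}" "D \<inter> (R \<times> ({1..n} - R)) = {}" for T R
    by (rule layer_eventI[of "\<lambda>v. if v \<in> T then 0 else if v \<in> R then 1 else 2"])
       (use that in \<open>auto simp: upward_arcs_def disjoint_iff split: if_splits\<close>)
  obtain S where S: "S \<subseteq> {1..n}" "s \<in> S" "a \<notin> S" "D \<inter> (S \<times> ({1..n} - S)) = {}"
    using np(1) no_path_iff_closed[OF D V(1)] by blast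
  obtain U where U: "U \<subseteq> {1..n}" "b \<in> U" "s \<notin> U" "D \<inter> (U \<times> ({1..n} - U)) = {}"
    using np(2) no_path_iff_closed[OF D V(3)] by blast
  consider "a \<notin> U" | "b \<in> S" | "a \<in> U" "b \<notin> S" by blast
  then show ?thesis
  proof cases
    case 1
    have "D \<in> layer_event" by (rule lay[of U "S \<union> U"]) (use S U 1 in auto)
    then show ?thesis by blast
  next
    case 2
    have "D \<in> layer_event" by (rule lay[of "S \<inter> U" S]) (use S U 2 in auto)
    then show ?thesis by blast
  next
    case 3
    then show ?thesis using S U unfolding twin_event_def by blast
  qed
qed

lemma layers_imp_joint:
  assumes D: "D \<subseteq> {1..n} \<times> {1..n}"
    and V: "s \<in> {1..n}" "a \<in> {1..n}" "b \<in> {1..n}" and ne: "s \<noteq> a" "s \<noteq> b" "a \<noteq> b"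
    and "D \<in> rooted_layers.layer_event n 3 (three_roots b s a)"
  shows "D \<in> no_path s a \<inter> no_path b s"
proof -
  interpret rooted_layers n 3 "three_roots b s a" by (rule rooted_layers_3) (use V ne in auto)
  show ?thesis
    using layer_event_no_path[OF D assms(8), of 1 2] layer_event_no_path[OF D assms(8), of 0 1] by simp
qed

text \<open>
The colour of a vertex records its membership in \<open>S\<close> and in \<open>U\<close>.
\<close>

definition leaving_arcs :: "nat \<Rightarrow> (nat \<Rightarrow> bool \<times> bool) \<Rightarrow> (nat \<times> nat) set" where
  "leaving_arcs n c = {(u, v). u \<in> {1..n} \<and> v \<in> {1..n} \<and>
     (fst (c u) \<and> \<not> fst (c v) \<or> snd (c u) \<and> \<not> snd (c v))}"

text \<open>
A vertex in exactly one of \<open>S\<close> and \<open>U\<close> has an edge to one of the roots that is forbidden in both directions, at the price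
\<open>1 - p\<close>. A vertex in both or in none has one-way constraints to all three roots, at the price \<open>x ^ 3\<close>, where
\<open>x = 1 - p / 2\<close>. Both prices are at most \<open>(1 - p\<^sup>2 / 4) * x\<^sup>2\<close>, so for \<open>p\<close> bounded away from \<open>0\<close> the event is exponentially
unlikely compared with \<open>x ^ (2 * n)\<close>.
\<close>

lemma prob_twin_event:
  assumes m: "m \<le> n choose 2" and p: "p = real m / real (n choose 2)"
    and V: "s \<in> {1..n}" "a \<in> {1..n}" "b \<in> {1..n}" and ne: "s \<noteq> a" "s \<noteq> b" "a \<noteq> b"
  shows "measure_pmf.prob (directed_Gnm n m) (twin_event n s a b) \<le>
    ((1 - p\<^sup>2 / 4) * (1 - p / 2)\<^sup>2) ^ (n - 3) *
      (4 * (1 + 3 * (1 - p / 2) ^ ((n - 3) div 4)) ^ (n - 3))"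
proof -
  let ?P = "measure_pmf.prob (directed_Gnm n m)" and ?x = "1 - p / 2"
  let ?X = "{s, a, b}"
  define W where "W = {1..n} - ?X"
  define h where "h = (1 - p\<^sup>2 / 4) * ?x\<^sup>2"
  define \<gamma> where "\<gamma> v = (v = s, v \<noteq> s)" for v :: nat
  let ?Col = "colourings {1..n} W \<gamma> UNIV"
  have p01: "0 \<le> p" "p \<le> 1" using m by (auto simp: p divide_le_eq_1)
  have x: "0 \<le> ?x" "?x \<le> 1" using p01 by auto
  have WV: "W \<union> ?X \<subseteq> {1..n}" "W \<inter> ?X = {}" using V by (auto simp: W_def)
  have cW: "card W = n - 3" unfolding W_def using V ne by (subst card_Diff_subset) auto
  \<comment> \<open>This is the exact difference between the two sides of \<open>1 - p \<le> h\<close>.\<close>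
  have "0 \<le> p ^ 3 * (4 - p) / 16" using p01 by (intro divide_nonneg_nonneg mult_nonneg_nonneg) auto
  also have "\<dots> = h - (1 - p)" unfolding h_def by (simp add: field_simps power2_eq_square power3_eq_cube)
  finally have h1: "1 - p \<le> h" by simp
  have h2: "?x * ?x * ?x \<le> h"
  proof -
    have "p * p \<le> p * 1" using p01 by (intro mult_left_mono) auto
    then have "?x \<le> 1 - p\<^sup>2 / 4" using p01 by (simp add: power2_eq_square)
    then have "?x * ?x\<^sup>2 \<le> h" unfolding h_def by (intro mult_right_mono) auto
    then show ?thesis by (simp add: power2_eq_square mult.assoc)
  qed
  have one: "?P (avoid (leaving_arcs n c)) \<le> h ^ (n - 3) * ?x ^ card (split_pairs W c)" if c: "c \<in> ?Col" for c
  proof -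
    let ?f = "\<lambda>u v. 1 - p + p * edge_weight (leaving_arcs n c) {u, v}"
    have fx: "?f u v \<le> ?x" if "u \<in> {1..n}" "v \<in> {1..n}" "c u \<noteq> c v" for u v
    proof -
      have "u \<noteq> v" using that by auto
      then have "edge_weight (leaving_arcs n c) {u, v} \<le> 1 / 2"
        using that by (auto simp: edge_weight_pair leaving_arcs_def prod_eq_iff of_bool_def)
      then have "p * edge_weight (leaving_arcs n c) {u, v} \<le> p * (1 / 2)"
        using p01 by (intro mult_left_mono)
      then show ?thesis by simp
    qed
    have f0: "?f u v = 1 - p" if "u \<in> {1..n}" "v \<in> {1..n}"
      "c u = (True, False) \<and> c v = (False, True) \<or> c u = (False, True) \<and> c v = (True, False)" for u v
    proof -
      have "u \<noteq> v" using that by auto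
      then show ?thesis using that by (auto simp: edge_weight_pair leaving_arcs_def)
    qed
    have f01: "0 \<le> ?f u v" "?f u v \<le> 1" for u v
      using p01 edge_weight_bounds[of "leaving_arcs n c" "{u, v}"]
        mult_left_le[of "edge_weight (leaving_arcs n c) {u, v}" p] mult_nonneg_nonneg[of p "edge_weight (leaving_arcs n c) {u, v}"]
      by auto
    have roots: "c s = (True, False)" "c a = (False, True)" "c b = (False, True)"
      using colouring_fixed[OF c] V ne by (auto simp: W_def \<gamma>_def)
    have "?P (avoid (leaving_arcs n c)) \<le> h ^ card W * ?x ^ card (split_pairs W c)"
    proof (rule prob_avoid_colouring[OF m p WV])
      fix v assume v: "v \<in> W"
      then have vV: "v \<in> {1..n}" by (simp add: W_def)
      have drop: "y \<le> h" if "0 \<le> z" "z \<le> 1" "y \<le> (1 - p) * z" for y z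
      proof -
        have "(1 - p) * z \<le> 1 - p" using that p01 by (intro mult_left_le) auto
        then show ?thesis using that h1 by simp
      qed
      have "?f s v * (?f a v * ?f b v) \<le> h"
      proof (cases "c v")
        case (Pair i j)
        consider "i" "\<not> j" | "\<not> i" "j" | "i = j" by blast
        then show ?thesis
        proof cases
          case 1
          then have "?f a v = 1 - p" using f0[OF V(2) vV] roots Pair by simp
          then have "?f s v * (?f a v * ?f b v) = (1 - p) * (?f s v * ?f b v)" by simp
          then show ?thesis
            using f01[of s v] f01[of b v] by (intro drop[of "?f s v * ?f b v"]) (auto intro: mult_le_one)
        next
          case 2
          then have "?f s v = 1 - p" using f0[OF V(1) vV] roots Pair by simp
          then show ?thesis
            using f01[of a v] f01[of b v] by (intro drop[of "?f a v * ?f b v"]) (auto intro: mult_le_one)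
        next
          case 3
          then have "?f s v \<le> ?x" "?f a v \<le> ?x" "?f b v \<le> ?x"
            using fx V vV roots Pair by auto
          then have "?f s v * (?f a v * ?f b v) \<le> ?x * (?x * ?x)"
            using f01 x by (intro mult_mono) auto
          then show ?thesis using h2 by (simp add: mult.assoc)
        qed
      qed
      then show "(\<Prod>u\<in>?X. ?f u v) \<le> h" using ne by simp
    next
      fix u v assume "u \<in> W" "v \<in> W" "c u \<noteq> c v"
      then show "?f u v \<le> ?x" by (intro fx) (auto simp: W_def)
    qed
    then show ?thesis by (simp add: cW)
  qed
  have "?P (twin_event n s a b) \<le> ?P (\<Union>c\<in>?Col. avoid (leaving_arcs n c))"
  proof (rule measure_pmf.finite_measure_mono)
    show "twin_event n s a b \<subseteq> (\<Union>c\<in>?Col. avoid (leaving_arcs n c))"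
    proof
      fix D assume "D \<in> twin_event n s a b"
      then obtain S U where SU: "s \<in> S - U" "a \<in> U - S" "b \<in> U - S"
        "D \<inter> (S \<times> ({1..n} - S)) = {}" "D \<inter> (U \<times> ({1..n} - U)) = {}"
        unfolding twin_event_def by blast
      define c where "c = restrict (\<lambda>v. (v \<in> S, v \<in> U)) {1..n}"
      have "c \<in> ?Col"
        unfolding colourings_def c_def using SU V ne by (auto simp: W_def \<gamma>_def)
      moreover have "D \<in> avoid (leaving_arcs n c)"
      proof -
        have False if uv: "(u, v) \<in> D" "(u, v) \<in> leaving_arcs n c" for u v
        proof -
          have "u \<in> {1..n}" "v \<in> {1..n}" using uv(2) by (auto simp: leaving_arcs_def)
          then have "u \<in> S \<and> v \<in> {1..n} - S \<or> u \<in> U \<and> v \<in> {1..n} - U"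
            using uv(2) by (auto simp: leaving_arcs_def c_def)
          then show False using SU(4,5) uv(1) by blast
        qed
        then show ?thesis by (auto simp: avoid_def)
      qed
      ultimately show "D \<in> (\<Union>c\<in>?Col. avoid (leaving_arcs n c))" by blast
    qed
  qed simp
  also have "\<dots> \<le> (\<Sum>c\<in>?Col. ?P (avoid (leaving_arcs n c)))"
    by (rule measure_pmf.finite_measure_subadditive_finite) (auto intro!: finite_colourings)
  also have "\<dots> \<le> (\<Sum>c\<in>?Col. h ^ (n - 3) * ?x ^ card (split_pairs W c))"
    by (intro sum_mono one)
  also have "\<dots> = h ^ (n - 3) * (\<Sum>c\<in>?Col. ?x ^ card (split_pairs W c))"
    by (simp add: sum_distrib_left)
  also have "\<dots> \<le> h ^ (n - 3) * (4 * (1 + 3 * ?x ^ ((n - 3) div 4)) ^ (n - 3))"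
  proof (rule mult_left_mono)
    have "card (UNIV :: (bool \<times> bool) set) = 4"
      by (simp add: card_cartesian_product flip: UNIV_Times_UNIV)
    then show "(\<Sum>c\<in>?Col. ?x ^ card (split_pairs W c)) \<le> 4 * (1 + 3 * ?x ^ ((n - 3) div 4)) ^ (n - 3)"
      using potts_sum_total[of "{1..n}" W "UNIV :: (bool \<times> bool) set" ?x \<gamma>] x cW
      by (simp add: W_def)
    show "0 \<le> h ^ (n - 3)" using h1 p01 by simp
  qed
  finally show ?thesis by (simp only: h_def)
qed

section \<open>Limits of the two probabilities\<close>

lemma (in rooted_layers) layer_event_pos:
  assumes "m \<le> n choose 2"
  shows "0 < measure_pmf.prob (directed_Gnm n m) layer_event"
proof -
  have "0 < one_way_avoidance (n choose 2) m base_pairs"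
    by (rule one_way_avoidance_pos[OF assms])
  also have "\<dots> = measure_pmf.prob (directed_Gnm n m) (avoid (upward_arcs n (flat 0)))"
    by (rule prob_flat[symmetric, OF assms r_pos])
  also have "\<dots> \<le> measure_pmf.prob (directed_Gnm n m) layer_event"
    unfolding layer_event_def using flat_layering[OF r_pos]
    by (intro measure_pmf.finite_measure_mono) auto
  finally show ?thesis .
qed

text \<open>
The number \<open>n - r\<close> is at most linear in the exponent \<open>(n - r) div q\<close>, while the power decays exponentially; \<open>1 + y \<le> exp y\<close>
does the rest.
\<close>

lemma minority_weight_tendsto_0:
  fixes x :: "nat \<Rightarrow> real"
  assumes x: "\<forall>\<^sub>F n in sequentially. 0 \<le> x n \<and> x n \<le> x0" and x0: "0 \<le> x0" "x0 < 1"
    and q: "0 < q" and a: "0 \<le> a"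
  shows "(\<lambda>n. (1 + a * x n ^ ((n - r) div q)) ^ (n - r) - 1) \<longlonglongrightarrow> 0"
proof -
  define M where "M n = n - r" for n :: nat
  define z where "z d = a * (real q * (real d + 1)) * x0 ^ d" for d :: nat
  have "(\<lambda>d. real d * x0 ^ d) \<longlonglongrightarrow> 0"
    by (rule powser_times_n_limit_0) (use x0 in auto)
  moreover have "(\<lambda>d. x0 ^ d) \<longlonglongrightarrow> 0" using x0 by (intro LIMSEQ_realpow_zero) auto
  ultimately have "(\<lambda>d. a * real q * (real d * x0 ^ d + x0 ^ d)) \<longlonglongrightarrow> a * real q * (0 + 0)"
    by (intro tendsto_mult_left tendsto_add)
  moreover have "z = (\<lambda>d. a * real q * (real d * x0 ^ d + x0 ^ d))"
    by (simp add: z_def fun_eq_iff algebra_simps)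
  ultimately have "z \<longlonglongrightarrow> 0" by simp
  moreover have "filterlim (\<lambda>n. M n div q) at_top sequentially"
    unfolding filterlim_at_top
  proof
    fix Z
    have "Z \<le> M n div q" if "q * Z + r \<le> n" for n
      using that q by (simp add: M_def less_eq_div_iff_mult_less_eq mult.commute)
    then show "\<forall>\<^sub>F n in sequentially. Z \<le> M n div q"
      by (rule eventually_sequentiallyI)
  qed
  ultimately have "(\<lambda>n. z (M n div q)) \<longlonglongrightarrow> 0" by (rule filterlim_compose)
  then have "(\<lambda>n. exp (z (M n div q)) - 1) \<longlonglongrightarrow> exp 0 - 1" by (intro tendsto_intros)
  then have lim: "(\<lambda>n. exp (z (M n div q)) - 1) \<longlonglongrightarrow> 0" by simp
  show ?thesis
  proof (rule tendsto_sandwich[OF _ _ tendsto_const lim])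
    show "\<forall>\<^sub>F n in sequentially. 0 \<le> (1 + a * x n ^ ((n - r) div q)) ^ (n - r) - 1"
      using x by eventually_elim (use a in \<open>auto intro!: one_le_power mult_nonneg_nonneg\<close>)
    show "\<forall>\<^sub>F n in sequentially. (1 + a * x n ^ ((n - r) div q)) ^ (n - r) - 1 \<le> exp (z (M n div q)) - 1"
      using x
    proof eventually_elim
      fix n assume xn: "0 \<le> x n \<and> x n \<le> x0"
      let ?d = "M n div q"
      let ?y = "a * x n ^ ?d"
      have y0: "0 \<le> ?y" using xn a by simp
      have "(1 + ?y) ^ M n \<le> exp ?y ^ M n"
        using y0 exp_ge_add_one_self[of ?y] by (intro power_mono) auto
      also have "\<dots> = exp (real (M n) * ?y)" by (simp add: exp_of_nat_mult)
      also have "real (M n) * ?y \<le> (real q * (real ?d + 1)) * (a * x0 ^ ?d)"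
      proof (rule mult_mono)
        have "M n < q * (?d + 1)" using q dividend_less_times_div[of q "M n"] by simp
        then have "real (M n) \<le> real (q * (?d + 1))" by (intro of_nat_mono less_imp_le)
        then show "real (M n) \<le> real q * (real ?d + 1)" by (simp only: of_nat_mult of_nat_add of_nat_1)
        show "?y \<le> a * x0 ^ ?d" using xn a by (intro mult_left_mono power_mono) auto
      qed (use y0 in auto)
      also have "\<dots> = z ?d" by (simp add: z_def)
      finally show "(1 + a * x n ^ ((n - r) div q)) ^ (n - r) - 1 \<le> exp (z ?d) - 1"
        by (simp add: M_def)
    qed
  qed
qed

text \<open>
A positive lower limit of the densities enters only through an eventual lower bound \<open>\<delta>\<close>, which keeps \<open>1 - p / 2\<close> away
from \<open>1\<close>.
\<close>

locale dense_directed_Gnm =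
  fixes m :: "nat \<Rightarrow> nat" and p :: "nat \<Rightarrow> real" and \<delta> :: real
  assumes m_le: "m n \<le> n choose 2"
    and p_eq: "p n = real (m n) / real (n choose 2)"
    and \<delta>_pos: "0 < \<delta>" and dense: "\<forall>\<^sub>F n in sequentially. \<delta> \<le> p n"
begin

abbreviation x :: "nat \<Rightarrow> real" where
  "x n \<equiv> 1 - p n / 2"

text \<open>
Sampling without replacement asymptotically multiplies the one-way avoidance probability of about \<open>(r - 1) n\<close> edges by
\<open>exp (- ((r - 1)\<^sup>2 * g))\<close>.
\<close>

definition g :: "nat \<Rightarrow> real" where
  "g n = p n * (1 - p n) / (2 - p n)\<^sup>2"

lemma p_bounds: "0 \<le> p n" "p n \<le> 1"
  using m_le[of n] by (auto simp: p_eq divide_le_eq_1)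

lemma x_bounds: "1 / 2 \<le> x n" "0 < x n" "x n \<le> 1"
  using p_bounds[of n] by auto

lemma \<delta>_le: "\<delta> \<le> 1"
proof -
  obtain n where "\<delta> \<le> p n" using dense by (auto simp: eventually_sequentially)
  then show ?thesis using p_bounds[of n] by simp
qed

lemma x_le: "\<forall>\<^sub>F n in sequentially. 0 \<le> x n \<and> x n \<le> 1 - \<delta> / 2"
  using dense by eventually_elim (use x_bounds in \<open>auto simp: less_imp_le\<close>)

lemma g_bounds: "0 \<le> g n" "g n \<le> 1"
proof -
  have "1 ^ 2 \<le> (2 - p n)\<^sup>2" using p_bounds[of n] by (intro power_mono) auto
  moreover have "p n * (1 - p n) \<le> 1" "0 \<le> p n * (1 - p n)"
    using p_bounds[of n] by (auto intro!: mult_le_one)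
  ultimately show "0 \<le> g n" "g n \<le> 1" by (auto simp: g_def divide_le_eq_1)
qed

text \<open>
Exponents that differ by a constant may be exchanged at the cost of a constant factor.
\<close>

lemma x_power_quotient:
  assumes "k = j + i"
  shows "x n ^ j / x n ^ k \<le> 2 ^ i"
proof -
  have "(1 / 2) ^ i \<le> x n ^ i" using x_bounds by (intro power_mono) auto
  then have "1 / x n ^ i \<le> 2 ^ i"
    using x_bounds(2)[of n] by (simp add: field_simps)
  then show ?thesis using x_bounds(2)[of n] by (simp add: assms power_add)
qed

lemma one_way_avoidance_limit:
  assumes r: "2 \<le> r"
  defines "k \<equiv> \<lambda>n. (r - 1) * (n - r) + (r choose 2)"
  shows "(\<lambda>n. one_way_avoidance (n choose 2) (m n) (k n) / x n ^ k n - exp (- ((real r - 1)\<^sup>2 * g n))) \<longlonglongrightarrow> 0"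
proof -
  define N where "N n = n choose 2" for n :: nat
  have N: "real (N n) = real n * (real n - 1) / 2" for n
    by (cases n) (auto simp: N_def choose_two real_of_nat_div algebra_simps)
  have k: "real (k n) = (real r - 1) * (real n - real r / 2)" if "r \<le> n" for n
  proof -
    have "real (r choose 2) = real r * (real r - 1) / 2"
      by (cases r) (auto simp: choose_two real_of_nat_div algebra_simps)
    then show ?thesis using that r by (simp add: k_def of_nat_diff field_simps)
  qed
  define t where "t n = real (k n) * sqrt (real (k n)) / real (N n)" for n
  have k_le: "real (k n) \<le> real r * real n" if "r \<le> n" for n
  proof -
    have "(real r - 1) * (real n - real r / 2) \<le> real r * real n"
      using that r by (intro mult_mono) auto
    then show ?thesis using k[OF that] by simp
  qed
  have t_lim: "t \<longlonglongrightarrow> 0"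
  proof (rule tendsto_sandwich[OF _ _ tendsto_const])
    show "\<forall>\<^sub>F n in sequentially. 0 \<le> t n" by (simp add: t_def)
    have "t n \<le> (real r * sqrt (real r)) * (real n * sqrt (real n) / (real n * (real n - 1) / 2))"
      if "r \<le> n" for n
    proof -
      have "real (k n) * sqrt (real (k n)) \<le> (real r * real n) * sqrt (real r * real n)"
        using k_le[OF that] by (intro mult_mono) auto
      then have "t n \<le> (real r * real n) * sqrt (real r * real n) / real (N n)"
        unfolding t_def by (intro divide_right_mono) auto
      also have "\<dots> = (real r * sqrt (real r)) * (real n * sqrt (real n) / (real n * (real n - 1) / 2))"
        by (simp only: N real_sqrt_mult times_divide_eq_right mult_ac)
      finally show ?thesis .
    qed
    then show "\<forall>\<^sub>F n in sequentially. t n \<le> (real r * sqrt (real r)) * (real n * sqrt (real n) / (real n * (real n - 1) / 2))"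
      by (rule eventually_sequentiallyI)
    have "(\<lambda>n. real n * sqrt (real n) / (real n * (real n - 1) / 2)) \<longlonglongrightarrow> 0" by real_asymp
    then show "(\<lambda>n. (real r * sqrt (real r)) * (real n * sqrt (real n) / (real n * (real n - 1) / 2))) \<longlonglongrightarrow> 0"
      by (rule tendsto_mult_right_zero)
  qed
  have c_lim: "(\<lambda>n. (real (k n))\<^sup>2 / (2 * real (N n)) - (real r - 1)\<^sup>2) \<longlonglongrightarrow> 0"
  proof -
    have "(\<lambda>n. (real n - c)\<^sup>2 / (real n * (real n - 1)) - 1) \<longlonglongrightarrow> 0" for c :: real by real_asymp
    then have "(\<lambda>n. (real r - 1)\<^sup>2 * ((real n - real r / 2)\<^sup>2 / (real n * (real n - 1)) - 1)) \<longlonglongrightarrow> 0"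
      by (rule tendsto_mult_right_zero)
    moreover have "\<forall>\<^sub>F n in sequentially. (real r - 1)\<^sup>2 * ((real n - real r / 2)\<^sup>2 / (real n * (real n - 1)) - 1) =
        (real (k n))\<^sup>2 / (2 * real (N n)) - (real r - 1)\<^sup>2"
    proof (rule eventually_sequentiallyI)
      fix n assume "r \<le> n"
      then have "(real (k n))\<^sup>2 = (real r - 1)\<^sup>2 * (real n - real r / 2)\<^sup>2" by (simp only: k power_mult_distrib)
      moreover have "2 * real (N n) = real n * (real n - 1)" by (simp add: N)
      ultimately show "(real r - 1)\<^sup>2 * ((real n - real r / 2)\<^sup>2 / (real n * (real n - 1)) - 1) =
          (real (k n))\<^sup>2 / (2 * real (N n)) - (real r - 1)\<^sup>2"
        by (simp only: right_diff_distrib times_divide_eq_right mult_1_right)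
    qed
    ultimately show ?thesis by (rule Lim_transform_eventually)
  qed
  have small: "\<forall>\<^sub>F n in sequentially. 2 * k n \<le> N n"
  proof -
    have "\<forall>\<^sub>F n in sequentially. 2 * (real r * real n) \<le> real n * (real n - 1) / 2" by real_asymp
    then show ?thesis using eventually_ge_at_top[of r]
    proof eventually_elim
      case (elim n)
      then have "2 * real (k n) \<le> real (N n)" using k_le[of n] by (simp add: N)
      then show ?case by linarith
    qed
  qed
  have k1: "1 \<le> k n" for n
  proof -
    have "0 < r choose 2" using r by simp
    then show ?thesis unfolding k_def by linarith
  qed
  show ?thesis
  proof (rule Lim_null_comparison)
    have "(\<lambda>n. 2 * t n + 3 / 2 * (t n)\<^sup>2 + \<bar>(real (k n))\<^sup>2 / (2 * real (N n)) - (real r - 1)\<^sup>2\<bar>) \<longlonglongrightarrow>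
        2 * 0 + 3 / 2 * 0\<^sup>2 + \<bar>0\<bar>"
      by (intro tendsto_intros t_lim c_lim)
    then show "(\<lambda>n. 2 * t n + 3 / 2 * (t n)\<^sup>2 + \<bar>(real (k n))\<^sup>2 / (2 * real (N n)) - (real r - 1)\<^sup>2\<bar>) \<longlonglongrightarrow> 0"
      by simp
    show "\<forall>\<^sub>F n in sequentially. norm (one_way_avoidance (n choose 2) (m n) (k n) / x n ^ k n -
          exp (- ((real r - 1)\<^sup>2 * g n))) \<le>
        2 * t n + 3 / 2 * (t n)\<^sup>2 + \<bar>(real (k n))\<^sup>2 / (2 * real (N n)) - (real r - 1)\<^sup>2\<bar>"
      using small
    proof eventually_elim
      case (elim n)
      let ?c = "(real (k n))\<^sup>2 / (2 * real (N n))"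
      have "\<bar>one_way_avoidance (N n) (m n) (k n) / x n ^ k n - exp (- (?c * g n))\<bar> \<le> 2 * t n + 3 / 2 * (t n)\<^sup>2"
        unfolding g_def t_def
        by (rule one_way_avoidance_approx) (use elim k1 m_le in \<open>auto simp: N_def p_eq\<close>)
      moreover have "\<bar>exp (- (?c * g n)) - exp (- ((real r - 1)\<^sup>2 * g n))\<bar> \<le> \<bar>?c * g n - (real r - 1)\<^sup>2 * g n\<bar>"
        by (rule exp_minus_lipschitz) (auto simp: g_bounds)
      moreover have "\<bar>?c * g n - (real r - 1)\<^sup>2 * g n\<bar> \<le> \<bar>?c - (real r - 1)\<^sup>2\<bar>"
      proof -
        have "\<bar>?c * h - d * h\<bar> \<le> \<bar>?c - d\<bar>" if "0 \<le> h" "h \<le> 1" for h d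
          using that mult_left_le[of h "\<bar>?c - d\<bar>"] by (simp only: left_diff_distrib[symmetric] abs_mult abs_of_nonneg)
        then show ?thesis using g_bounds by blast
      qed
      ultimately show ?case unfolding N_def[symmetric] real_norm_def by linarith
    qed
  qed
qed

text \<open>
All error terms of \<open>layer_event_upper\<close> and \<open>layer_event_lower\<close> stay negligible after division by \<open>x ^ k\<close>, since \<open>k\<close> exceeds
\<open>(r - 1) * (n - r)\<close> by the constant \<open>r choose 2\<close> only and \<open>x \<ge> 1/2\<close>.
\<close>

lemma layer_event_limit:
  assumes r: "2 \<le> r" and layers: "\<And>n. n0 \<le> n \<Longrightarrow> rooted_layers n r \<rho>"
  defines "k \<equiv> \<lambda>n. (r - 1) * (n - r) + (r choose 2)"
  shows "(\<lambda>n. measure_pmf.prob (directed_Gnm n (m n)) (rooted_layers.layer_event n r \<rho>) / x n ^ k n -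
    real r * exp (- ((real r - 1)\<^sup>2 * g n))) \<longlonglongrightarrow> 0"
proof -
  define Q where "Q n = one_way_avoidance (n choose 2) (m n) (k n)" for n
  define P where "P n = measure_pmf.prob (directed_Gnm n (m n)) (rooted_layers.layer_event n r \<rho>)" for n
  define E where "E n = (1 + real (r - 1) * x n ^ ((n - r) div r)) ^ (n - r) - 1" for n
  define C where "C = (2 :: real) ^ (r choose 2)"
  have r0: "0 < r" using r by simp
  have E_lim: "E \<longlonglongrightarrow> 0"
    unfolding E_def using minority_weight_tendsto_0[OF x_le _ _ r0, of "real (r - 1)" r] \<delta>_pos \<delta>_le by simp
  have E0: "0 \<le> E n" for n
    unfolding E_def using x_bounds(2)[of n] by (auto intro!: one_le_power mult_nonneg_nonneg zero_le_power)
  have bound: "\<bar>P n / x n ^ k n - real r * (Q n / x n ^ k n)\<bar> \<le> C * real r * E n + (real r)\<^sup>2 * C * x n ^ (n - r)"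
    if n: "n0 \<le> n" for n
  proof -
    interpret rooted_layers n r \<rho> by (rule layers[OF n])
    have bp: "base_pairs = k n" by (simp add: base_pairs_def k_def)
    have xk: "0 < x n ^ k n" using x_bounds by simp
    have quot: "x n ^ ((r - 1) * (n - r)) / x n ^ k n \<le> C"
      unfolding C_def k_def by (rule x_power_quotient) simp
    have "P n \<le> real r * Q n + x n ^ ((r - 1) * (n - r)) * (real r * E n)"
      using layer_event_upper[OF m_le[of n] p_eq[of n]] by (simp add: P_def Q_def E_def bp)
    then have "P n / x n ^ k n \<le> real r * (Q n / x n ^ k n) + x n ^ ((r - 1) * (n - r)) / x n ^ k n * (real r * E n)"
      using xk divide_right_mono[of _ _ "x n ^ k n"] by (fastforce simp: add_divide_distrib)
    also have "x n ^ ((r - 1) * (n - r)) / x n ^ k n * (real r * E n) \<le> C * (real r * E n)"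
      using quot E0 by (intro mult_right_mono) auto
    finally have up: "P n / x n ^ k n - real r * (Q n / x n ^ k n) \<le> C * real r * E n" by simp
    have "real r * Q n - (real r)\<^sup>2 * x n ^ (r * (n - r)) \<le> P n"
      using layer_event_lower[OF m_le[of n] p_eq[of n]] by (simp add: P_def Q_def bp)
    then have "real r * (Q n / x n ^ k n) - (real r)\<^sup>2 * (x n ^ (r * (n - r)) / x n ^ k n) \<le> P n / x n ^ k n"
      using xk divide_right_mono[of _ _ "x n ^ k n"] by (fastforce simp: diff_divide_distrib)
    moreover have "x n ^ (r * (n - r)) / x n ^ k n \<le> C * x n ^ (n - r)"
    proof -
      have "r * (n - r) = (r - 1) * (n - r) + (n - r)" using r by (cases r) auto
      then have "x n ^ (r * (n - r)) / x n ^ k n = x n ^ ((r - 1) * (n - r)) / x n ^ k n * x n ^ (n - r)"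
        by (simp add: power_add)
      also have "\<dots> \<le> C * x n ^ (n - r)"
        using quot x_bounds(2)[of n] by (intro mult_right_mono) auto
      finally show ?thesis .
    qed
    then have "(real r)\<^sup>2 * (x n ^ (r * (n - r)) / x n ^ k n) \<le> (real r)\<^sup>2 * (C * x n ^ (n - r))"
      by (intro mult_left_mono) auto
    ultimately have lo: "real r * (Q n / x n ^ k n) - P n / x n ^ k n \<le> (real r)\<^sup>2 * C * x n ^ (n - r)" by simp
    have "0 \<le> C * real r * E n" "0 \<le> (real r)\<^sup>2 * C * x n ^ (n - r)"
      using E0 x_bounds(2)[of n] by (simp_all add: C_def)
    then show ?thesis using up lo by linarith
  qed
  have x_lim: "(\<lambda>n. x n ^ (n - r)) \<longlonglongrightarrow> 0"
  proof (rule tendsto_sandwich[OF _ _ tendsto_const])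
    show "\<forall>\<^sub>F n in sequentially. 0 \<le> x n ^ (n - r)" using x_bounds(2) by (simp add: less_imp_le)
    show "\<forall>\<^sub>F n in sequentially. x n ^ (n - r) \<le> (1 - \<delta> / 2) ^ (n - r)"
      using x_le by eventually_elim (auto intro: power_mono)
    have "(\<lambda>n. (1 - \<delta> / 2) ^ n) \<longlonglongrightarrow> 0"
      using \<delta>_pos \<delta>_le by (intro LIMSEQ_realpow_zero) auto
    then show "(\<lambda>n. (1 - \<delta> / 2) ^ (n - r)) \<longlonglongrightarrow> 0"
      by (rule filterlim_compose) (rule filterlim_minus_const_nat_at_top)
  qed
  have "(\<lambda>n. P n / x n ^ k n - real r * (Q n / x n ^ k n)) \<longlonglongrightarrow> 0"
  proof (rule Lim_null_comparison)
    show "\<forall>\<^sub>F n in sequentially. norm (P n / x n ^ k n - real r * (Q n / x n ^ k n)) \<le>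
        C * real r * E n + (real r)\<^sup>2 * C * x n ^ (n - r)"
      using bound by (auto intro: eventually_sequentiallyI[of n0])
    have "(\<lambda>n. C * real r * E n + (real r)\<^sup>2 * C * x n ^ (n - r)) \<longlonglongrightarrow> C * real r * 0 + (real r)\<^sup>2 * C * 0"
      by (intro tendsto_intros E_lim x_lim)
    then show "(\<lambda>n. C * real r * E n + (real r)\<^sup>2 * C * x n ^ (n - r)) \<longlonglongrightarrow> 0" by simp
  qed
  moreover have "(\<lambda>n. real r * (Q n / x n ^ k n - exp (- ((real r - 1)\<^sup>2 * g n)))) \<longlonglongrightarrow> 0"
    unfolding Q_def k_def by (intro tendsto_mult_right_zero one_way_avoidance_limit r)
  ultimately have "(\<lambda>n. (P n / x n ^ k n - real r * (Q n / x n ^ k n)) +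
      real r * (Q n / x n ^ k n - exp (- ((real r - 1)\<^sup>2 * g n)))) \<longlonglongrightarrow> 0 + 0"
    by (rule tendsto_add)
  then show ?thesis by (simp add: P_def right_diff_distrib)
qed

lemma single_limit:
  "(\<lambda>n. measure_pmf.prob (directed_Gnm n (m n)) (no_path 1 2) / x n ^ (n - 1) - 2 * exp (- g n)) \<longlonglongrightarrow> 0"
proof -
  have "(\<lambda>n. measure_pmf.prob (directed_Gnm n (m n)) (rooted_layers.layer_event n 2 (two_roots 1 2)) /
      x n ^ ((2 - 1) * (n - 2) + (2 choose 2)) - real 2 * exp (- ((real 2 - 1)\<^sup>2 * g n))) \<longlonglongrightarrow> 0"
    by (rule layer_event_limit[of 2 2]) (auto intro!: rooted_layers_2)
  then show ?thesis
  proof (rule Lim_transform_eventually)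
    show "\<forall>\<^sub>F n in sequentially. measure_pmf.prob (directed_Gnm n (m n)) (rooted_layers.layer_event n 2 (two_roots 1 2)) /
        x n ^ ((2 - 1) * (n - 2) + (2 choose 2)) - real 2 * exp (- ((real 2 - 1)\<^sup>2 * g n)) =
      measure_pmf.prob (directed_Gnm n (m n)) (no_path 1 2) / x n ^ (n - 1) - 2 * exp (- g n)"
    proof (rule eventually_sequentiallyI[of 2])
      fix n :: nat assume n: "2 \<le> n"
      then have "(2 - 1) * (n - 2) + (2 choose 2) = n - 1" by simp
      then show "measure_pmf.prob (directed_Gnm n (m n)) (rooted_layers.layer_event n 2 (two_roots 1 2)) /
          x n ^ ((2 - 1) * (n - 2) + (2 choose 2)) - real 2 * exp (- ((real 2 - 1)\<^sup>2 * g n)) =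
        measure_pmf.prob (directed_Gnm n (m n)) (no_path 1 2) / x n ^ (n - 1) - 2 * exp (- g n)"
        using prob_no_path_layers[OF m_le, of 1 n 2] n by simp
    qed
  qed
qed

lemma twin_limit:
  "(\<lambda>n. measure_pmf.prob (directed_Gnm n (m n)) (twin_event n 1 2 3) / x n ^ (2 * n - 3)) \<longlonglongrightarrow> 0"
proof -
  define E where "E n = (1 + 3 * x n ^ ((n - 3) div 4)) ^ (n - 3) - 1" for n
  have E_lim: "E \<longlonglongrightarrow> 0"
    unfolding E_def using minority_weight_tendsto_0[OF x_le, of 4 3 3] \<delta>_pos \<delta>_le by simp
  define \<theta> where "\<theta> = 1 - \<delta>\<^sup>2 / 4"
  have \<theta>: "0 \<le> \<theta>" "\<theta> < 1" using \<delta>_pos \<delta>_le power_le_one[of \<delta> 2] by (auto simp: \<theta>_def)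
  have "(\<lambda>n. \<theta> ^ n) \<longlonglongrightarrow> 0" using \<theta> by (intro LIMSEQ_realpow_zero)
  then have \<theta>_lim: "(\<lambda>n. \<theta> ^ (n - 3)) \<longlonglongrightarrow> 0"
    by (rule filterlim_compose) (rule filterlim_minus_const_nat_at_top)
  show ?thesis
  proof (rule tendsto_sandwich[OF _ _ tendsto_const])
    show "\<forall>\<^sub>F n in sequentially. 0 \<le> measure_pmf.prob (directed_Gnm n (m n)) (twin_event n 1 2 3) / x n ^ (2 * n - 3)"
      using x_bounds(2) by (simp add: less_imp_le)
    show "\<forall>\<^sub>F n in sequentially. measure_pmf.prob (directed_Gnm n (m n)) (twin_event n 1 2 3) / x n ^ (2 * n - 3) \<le>
        \<theta> ^ (n - 3) * 8 * (4 * (E n + 1))"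
      using dense eventually_ge_at_top[of 3]
    proof eventually_elim
      case (elim n)
      have xk: "0 < x n ^ (2 * n - 3)" using x_bounds by simp
      have E1: "0 \<le> E n + 1" using x_bounds(2)[of n] by (auto simp: E_def)
      have "\<delta>\<^sup>2 \<le> (p n)\<^sup>2" using elim \<delta>_pos by (intro power_mono) auto
      then have \<theta>n: "0 \<le> 1 - (p n)\<^sup>2 / 4" "1 - (p n)\<^sup>2 / 4 \<le> \<theta>"
        using p_bounds[of n] power_le_one[of "p n" 2] by (auto simp: \<theta>_def)
      have "measure_pmf.prob (directed_Gnm n (m n)) (twin_event n 1 2 3) \<le>
          ((1 - (p n)\<^sup>2 / 4) * (x n)\<^sup>2) ^ (n - 3) * (4 * (E n + 1))"
        using prob_twin_event[OF m_le p_eq, of 1 n 2 3] elim by (simp add: E_def)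
      also have "\<dots> = (1 - (p n)\<^sup>2 / 4) ^ (n - 3) * x n ^ (2 * (n - 3)) * (4 * (E n + 1))"
        by (simp only: power_mult_distrib power_mult)
      also have "\<dots> \<le> \<theta> ^ (n - 3) * x n ^ (2 * (n - 3)) * (4 * (E n + 1))"
        using \<theta>n E1 x_bounds(2)[of n] by (intro mult_right_mono power_mono) auto
      finally have "measure_pmf.prob (directed_Gnm n (m n)) (twin_event n 1 2 3) / x n ^ (2 * n - 3) \<le>
          (\<theta> ^ (n - 3) * x n ^ (2 * (n - 3)) * (4 * (E n + 1))) / x n ^ (2 * n - 3)"
        using xk by (intro divide_right_mono) auto
      also have "\<dots> = \<theta> ^ (n - 3) * (x n ^ (2 * (n - 3)) / x n ^ (2 * n - 3)) * (4 * (E n + 1))" by simp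
      also have "\<dots> \<le> \<theta> ^ (n - 3) * 8 * (4 * (E n + 1))"
      proof -
        have "x n ^ (2 * (n - 3)) / x n ^ (2 * n - 3) \<le> 2 ^ 3"
          by (rule x_power_quotient) (use elim in simp)
        then show ?thesis using \<theta> E1 by (intro mult_right_mono mult_left_mono) auto
      qed
      finally show ?case .
    qed
    have "(\<lambda>n. \<theta> ^ (n - 3) * 8 * (4 * (E n + 1))) \<longlonglongrightarrow> 0 * 8 * (4 * (0 + 1))"
      by (intro tendsto_intros \<theta>_lim E_lim)
    then show "(\<lambda>n. \<theta> ^ (n - 3) * 8 * (4 * (E n + 1))) \<longlonglongrightarrow> 0" by simp
  qed
qed

lemma joint_limit:
  "(\<lambda>n. measure_pmf.prob (directed_Gnm n (m n)) (no_path 1 2 \<inter> no_path 3 1) / x n ^ (2 * n - 3) -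
    3 * exp (- (4 * g n))) \<longlonglongrightarrow> 0"
proof -
  define L where "L n = measure_pmf.prob (directed_Gnm n (m n)) (rooted_layers.layer_event n 3 (three_roots 3 1 2))" for n
  define T where "T n = measure_pmf.prob (directed_Gnm n (m n)) (twin_event n 1 2 3)" for n
  define J where "J n = measure_pmf.prob (directed_Gnm n (m n)) (no_path 1 2 \<inter> no_path 3 1)" for n
  have L_lim: "(\<lambda>n. L n / x n ^ (2 * n - 3) - 3 * exp (- (4 * g n))) \<longlonglongrightarrow> 0"
  proof -
    have "(\<lambda>n. L n / x n ^ ((3 - 1) * (n - 3) + (3 choose 2)) - real 3 * exp (- ((real 3 - 1)\<^sup>2 * g n))) \<longlonglongrightarrow> 0"
      unfolding L_def by (rule layer_event_limit[of 3 3]) (auto intro!: rooted_layers_3)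
    then show ?thesis
    proof (rule Lim_transform_eventually)
      show "\<forall>\<^sub>F n in sequentially. L n / x n ^ ((3 - 1) * (n - 3) + (3 choose 2)) - real 3 * exp (- ((real 3 - 1)\<^sup>2 * g n)) =
        L n / x n ^ (2 * n - 3) - 3 * exp (- (4 * g n))"
      proof (rule eventually_sequentiallyI[of 3])
        fix n :: nat assume n: "3 \<le> n"
        then have "(3 - 1) * (n - 3) + (3 choose 2) = 2 * n - 3" by (simp add: choose_two)
        then show "L n / x n ^ ((3 - 1) * (n - 3) + (3 choose 2)) - real 3 * exp (- ((real 3 - 1)\<^sup>2 * g n)) =
          L n / x n ^ (2 * n - 3) - 3 * exp (- (4 * g n))" by simp
      qed
    qed
  qed
  have bound: "L n \<le> J n" "J n \<le> L n + T n" if n: "3 \<le> n" for n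
  proof -
    have V: "1 \<in> {1..n}" "2 \<in> {1..n}" "3 \<in> {1..n}" using n by auto
    show "L n \<le> J n"
      unfolding L_def J_def
      by (rule prob_mono_oriented[OF m_le]) (use V in \<open>auto dest!: layers_imp_joint[rotated -1]\<close>)
    have "J n \<le> measure_pmf.prob (directed_Gnm n (m n))
        (rooted_layers.layer_event n 3 (three_roots 3 1 2) \<union> twin_event n 1 2 3)"
      unfolding J_def
    proof (rule prob_mono_oriented[OF m_le])
      fix D assume "D \<subseteq> {1..n} \<times> {1..n}" "D \<in> no_path 1 2 \<inter> no_path 3 1"
      then show "D \<in> rooted_layers.layer_event n 3 (three_roots 3 1 2) \<union> twin_event n 1 2 3"
        using joint_layers_or_twin[of D n 1 2 3] V by simp
    qed
    also have "\<dots> \<le> L n + T n"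
      unfolding L_def T_def by (rule measure_Un_le) auto
    finally show "J n \<le> L n + T n" .
  qed
  have "(\<lambda>n. (J n - L n) / x n ^ (2 * n - 3)) \<longlonglongrightarrow> 0"
  proof (rule tendsto_sandwich[OF _ _ tendsto_const twin_limit])
    show "\<forall>\<^sub>F n in sequentially. 0 \<le> (J n - L n) / x n ^ (2 * n - 3)"
      using eventually_ge_at_top[of 3]
      by eventually_elim (use bound x_bounds(2) in \<open>auto intro!: divide_nonneg_nonneg simp: less_imp_le\<close>)
    show "\<forall>\<^sub>F n in sequentially. (J n - L n) / x n ^ (2 * n - 3) \<le>
        measure_pmf.prob (directed_Gnm n (m n)) (twin_event n 1 2 3) / x n ^ (2 * n - 3)"
      using eventually_ge_at_top[of 3]
    proof eventually_elim
      case (elim n)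
      then show ?case using bound[of n] x_bounds(2)[of n] unfolding T_def by (intro divide_right_mono) auto
    qed
  qed
  then have "(\<lambda>n. (J n - L n) / x n ^ (2 * n - 3) + (L n / x n ^ (2 * n - 3) - 3 * exp (- (4 * g n)))) \<longlonglongrightarrow> 0 + 0"
    using L_lim by (rule tendsto_add)
  then show ?thesis by (simp add: J_def diff_divide_distrib)
qed

end




section \<open>The covariance\<close>

text \<open>
The main terms oscillate with \<open>p\<close> instead of converging. As they are bounded away from \<open>0\<close>, differences
tending to \<open>0\<close> may be replaced by ratios tending to \<open>1\<close>, to which the limit laws for products apply.
\<close>

lemma ratio_tendsto_1:
  fixes u U :: "nat \<Rightarrow> real"
  assumes lim: "(\<lambda>n. u n - U n) \<longlonglongrightarrow> 0" and c: "0 < c" "\<And>n. c \<le> U n"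
  shows "(\<lambda>n. u n / U n) \<longlonglongrightarrow> 1"
proof -
  have "(\<lambda>n. (u n - U n) / U n) \<longlonglongrightarrow> 0"
  proof (rule tendsto_0_le[OF lim, of _ "1 / c"])
    have "\<bar>u n - U n\<bar> / \<bar>U n\<bar> \<le> \<bar>u n - U n\<bar> / c" for n
      using c(1) c(2)[of n] by (intro divide_left_mono) auto
    then show "\<forall>\<^sub>F n in sequentially. norm ((u n - U n) / U n) \<le> norm (u n - U n) * (1 / c)"
      by (simp add: abs_divide)
  qed
  then have "(\<lambda>n. (u n - U n) / U n + 1) \<longlonglongrightarrow> 0 + 1" by (intro tendsto_intros)
  moreover have "(u n - U n) / U n + 1 = u n / U n" for n
    using c(1) c(2)[of n] by (simp add: field_simps)
  ultimately show ?thesis by simp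
qed

lemma bounded_times_null:
  fixes b f :: "nat \<Rightarrow> real"
  assumes "f \<longlonglongrightarrow> 0" "\<And>n. \<bar>b n\<bar> \<le> B"
  shows "(\<lambda>n. b n * f n) \<longlonglongrightarrow> 0"
proof (rule tendsto_0_le[OF assms(1), of _ B])
  have "\<bar>b n\<bar> * \<bar>f n\<bar> \<le> B * \<bar>f n\<bar>" for n using assms(2) by (intro mult_right_mono) auto
  then show "\<forall>\<^sub>F n in sequentially. norm (b n * f n) \<le> norm (f n) * B"
    by (simp add: abs_mult mult.commute)
qed

context dense_directed_Gnm
begin

definition single_prob :: "nat \<Rightarrow> real" where
  "single_prob n = measure_pmf.prob (directed_Gnm n (m n)) (no_path 1 2)"

definition joint_prob :: "nat \<Rightarrow> real" where
  "joint_prob n = measure_pmf.prob (directed_Gnm n (m n)) (no_path 1 2 \<inter> no_path 3 1)"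

lemma single_prob_pos: "2 \<le> n \<Longrightarrow> 0 < single_prob n"
  using rooted_layers.layer_event_pos[OF rooted_layers_2 m_le, of 1 n 2] prob_no_path_layers[OF m_le, of 1 n 2]
  by (simp add: single_prob_def)

lemma single_ratio: "(\<lambda>n. single_prob n / (2 * x n ^ (n - 1) * exp (- g n))) \<longlonglongrightarrow> 1"
proof -
  have "(\<lambda>n. single_prob n / x n ^ (n - 1) / (2 * exp (- g n))) \<longlonglongrightarrow> 1"
  proof (rule ratio_tendsto_1)
    show "(\<lambda>n. single_prob n / x n ^ (n - 1) - 2 * exp (- g n)) \<longlonglongrightarrow> 0"
      unfolding single_prob_def by (rule single_limit)
    show "2 * exp (- 1) \<le> 2 * exp (- g n)" for n using g_bounds[of n] by simp
  qed simp
  then show ?thesis by (simp add: mult_ac)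
qed

lemma joint_ratio: "(\<lambda>n. joint_prob n / (3 * x n ^ (2 * n - 3) * exp (- (4 * g n)))) \<longlonglongrightarrow> 1"
proof -
  have "(\<lambda>n. joint_prob n / x n ^ (2 * n - 3) / (3 * exp (- (4 * g n)))) \<longlonglongrightarrow> 1"
  proof (rule ratio_tendsto_1)
    show "(\<lambda>n. joint_prob n / x n ^ (2 * n - 3) - 3 * exp (- (4 * g n))) \<longlonglongrightarrow> 0"
      unfolding joint_prob_def by (rule joint_limit)
    show "3 * exp (- 4) \<le> 3 * exp (- (4 * g n))" for n using g_bounds[of n] by simp
  qed simp
  then show ?thesis by (simp add: mult_ac)
qed

text \<open>
One factor \<open>x\<close> survives, because the joint event constrains \<open>2 n - 3\<close> edges and the square of the single one
\<open>2 n - 2\<close>.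
\<close>

lemma covariance_relative_to_square:
  "(\<lambda>n. (joint_prob n - (single_prob n)\<^sup>2) / (single_prob n)\<^sup>2 - (3 / (4 - 2 * p n) * exp (- (2 * g n)) - 1)) \<longlonglongrightarrow> 0"
proof -
  define u where "u n = single_prob n / (2 * x n ^ (n - 1) * exp (- g n))" for n
  define w where "w n = joint_prob n / (3 * x n ^ (2 * n - 3) * exp (- (4 * g n)))" for n
  have "(\<lambda>n. w n / (u n)\<^sup>2 - 1) \<longlonglongrightarrow> 1 / 1\<^sup>2 - 1"
    unfolding u_def w_def by (intro tendsto_intros single_ratio joint_ratio) simp
  then have "(\<lambda>n. (3 / (4 - 2 * p n) * exp (- (2 * g n))) * (w n / (u n)\<^sup>2 - 1)) \<longlonglongrightarrow> 0"
  proof (rule bounded_times_null[OF tendsto_eq_rhs])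
    fix n
    have "3 / (4 - 2 * p n) \<le> 3 / 2" using p_bounds[of n] by (intro divide_left_mono) auto
    moreover have "0 \<le> 3 / (4 - 2 * p n)" using p_bounds[of n] by auto
    moreover have "exp (- (2 * g n)) \<le> 1" using g_bounds[of n] by simp
    ultimately show "\<bar>3 / (4 - 2 * p n) * exp (- (2 * g n))\<bar> \<le> 3 / 2 * 1"
      unfolding abs_mult by (intro mult_mono) auto
  qed simp
  moreover have "\<forall>\<^sub>F n in sequentially. (3 / (4 - 2 * p n) * exp (- (2 * g n))) * (w n / (u n)\<^sup>2 - 1) =
      (joint_prob n - (single_prob n)\<^sup>2) / (single_prob n)\<^sup>2 - (3 / (4 - 2 * p n) * exp (- (2 * g n)) - 1)"
  proof (rule eventually_sequentiallyI)
    fix n :: nat assume n: "2 \<le> n"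
    have P0: "0 < single_prob n" by (rule single_prob_pos[OF n])
    have x0: "0 < x n" by (rule x_bounds)
    define e where "e = exp (- g n)"
    have e0: "0 < e" by (simp add: e_def)
    have e: "exp (- (2 * g n)) = e ^ 2" "exp (- (4 * g n)) = e ^ 4"
      unfolding e_def by (simp_all flip: exp_of_nat_mult)
    define y where "y = x n ^ (2 * n - 3)"
    have y0: "0 < y" using x0 by (simp add: y_def)
    have "2 * (n - 1) = Suc (2 * n - 3)" using n by simp
    then have xx: "(x n ^ (n - 1))\<^sup>2 = y * x n"
      by (simp add: y_def mult.commute[of _ 2] flip: power_mult)
    have "(u n)\<^sup>2 = (single_prob n)\<^sup>2 / (4 * (y * x n) * e ^ 2)"
      unfolding u_def e_def[symmetric] power_divide power_mult_distrib xx by simp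
    moreover have "w n = joint_prob n / (3 * y * e ^ 4)" by (simp add: w_def y_def e)
    moreover have "joint_prob n / (3 * y * e ^ 4) / ((single_prob n)\<^sup>2 / (4 * (y * z) * e ^ 2)) = (4 * z / (3 * e ^ 2)) * (joint_prob n / (single_prob n)\<^sup>2)"
      if "0 < z" for z
    proof -
      have cancel: "j / (3 * y * (E * E)) / (q / (4 * (y * z) * E)) = (4 * z / (3 * E)) * (j / q)"
        if "0 < E" "0 < q" for E q j :: real
        using that y0 \<open>0 < z\<close> by (simp add: divide_simps)
      have "e ^ 4 = e ^ 2 * e ^ 2" by (simp flip: power_add)
      then show ?thesis using cancel[of "e ^ 2" "(single_prob n)\<^sup>2" "joint_prob n"] e0 P0 by simp
    qed
    ultimately have "w n / (u n)\<^sup>2 = (4 * x n / (3 * e ^ 2)) * (joint_prob n / (single_prob n)\<^sup>2)"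
      using x0 by (simp only:)
    moreover have "3 / (4 * z) * E * ((4 * z / (3 * E)) * t) = t" if "0 < z" "0 < E" for z E t :: real
      using that by simp
    moreover have x4: "4 - 2 * p n = 4 * x n" by simp
    moreover have "0 < e ^ 2" using e0 by simp
    ultimately have "3 / (4 - 2 * p n) * exp (- (2 * g n)) * (w n / (u n)\<^sup>2) = joint_prob n / (single_prob n)\<^sup>2"
      unfolding x4 e using x0 by metis
    then show "3 / (4 - 2 * p n) * exp (- (2 * g n)) * (w n / (u n)\<^sup>2 - 1) =
      (joint_prob n - (single_prob n)\<^sup>2) / (single_prob n)\<^sup>2 - (3 / (4 - 2 * p n) * exp (- (2 * g n)) - 1)"
      using P0 by (simp add: right_diff_distrib diff_divide_distrib)
  qed
  ultimately show ?thesis by (rule Lim_transform_eventually)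
qed

lemma covariance_absolute:
  "(\<lambda>n. (joint_prob n - (single_prob n)\<^sup>2) / (x n ^ (2 * n - 3) * exp (- (2 * g n))) -
     (3 * exp (- (2 * g n)) - 4 + 2 * p n)) \<longlonglongrightarrow> 0"
proof -
  define u where "u n = single_prob n / (2 * x n ^ (n - 1) * exp (- g n))" for n
  define w where "w n = joint_prob n / (3 * x n ^ (2 * n - 3) * exp (- (4 * g n)))" for n
  have "(\<lambda>n. w n - 1) \<longlonglongrightarrow> 1 - 1"
    unfolding w_def by (intro tendsto_intros joint_ratio)
  then have "(\<lambda>n. 3 * exp (- (2 * g n)) * (w n - 1)) \<longlonglongrightarrow> 0"
    by (intro bounded_times_null[of _ _ 3]) (auto simp: abs_mult g_bounds)
  moreover have "(\<lambda>n. (u n)\<^sup>2 - 1) \<longlonglongrightarrow> 1\<^sup>2 - 1"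
    unfolding u_def by (intro tendsto_intros single_ratio)
  then have "(\<lambda>n. 4 * x n * ((u n)\<^sup>2 - 1)) \<longlonglongrightarrow> 0"
  proof (intro bounded_times_null[of _ _ 4])
    show "\<bar>4 * x n\<bar> \<le> 4" for n using x_bounds[of n] p_bounds[of n] by (simp add: abs_if)
  qed simp
  ultimately have "(\<lambda>n. 3 * exp (- (2 * g n)) * (w n - 1) - 4 * x n * ((u n)\<^sup>2 - 1)) \<longlonglongrightarrow> 0 - 0"
    by (rule tendsto_diff)
  then have "(\<lambda>n. 3 * exp (- (2 * g n)) * (w n - 1) - 4 * x n * ((u n)\<^sup>2 - 1)) \<longlonglongrightarrow> 0" by simp
  moreover have "\<forall>\<^sub>F n in sequentially. 3 * exp (- (2 * g n)) * (w n - 1) - 4 * x n * ((u n)\<^sup>2 - 1) =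
      (joint_prob n - (single_prob n)\<^sup>2) / (x n ^ (2 * n - 3) * exp (- (2 * g n))) - (3 * exp (- (2 * g n)) - 4 + 2 * p n)"
  proof (rule eventually_sequentiallyI)
    fix n :: nat assume n: "2 \<le> n"
    have x0: "0 < x n" by (rule x_bounds)
    define e where "e = exp (- g n)"
    have e0: "0 < e" by (simp add: e_def)
    have e: "exp (- (2 * g n)) = e ^ 2" "exp (- (4 * g n)) = e ^ 4"
      unfolding e_def by (simp_all flip: exp_of_nat_mult)
    define y where "y = x n ^ (2 * n - 3)"
    have y0: "0 < y" using x0 by (simp add: y_def)
    have "2 * (n - 1) = Suc (2 * n - 3)" using n by simp
    then have xx: "(x n ^ (n - 1))\<^sup>2 = y * x n"
      by (simp add: y_def mult.commute[of _ 2] flip: power_mult)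
    have "(u n)\<^sup>2 = (single_prob n)\<^sup>2 / (4 * (y * x n) * e ^ 2)"
      unfolding u_def e_def[symmetric] power_divide power_mult_distrib xx by simp
    moreover have "4 * z * ((single_prob n)\<^sup>2 / (4 * (y * z) * e ^ 2)) = (single_prob n)\<^sup>2 / (y * e ^ 2)" if "0 < z" for z
      using that by simp
    ultimately have u: "4 * x n * (u n)\<^sup>2 = (single_prob n)\<^sup>2 / (y * e ^ 2)"
      using x0 by (simp only:)
    have "w n = joint_prob n / (3 * y * e ^ 4)" by (simp add: w_def y_def e)
    then have w: "3 * e ^ 2 * w n = joint_prob n / (y * e ^ 2)"
      using e0 by (simp add: power2_eq_square power4_eq_xxxx)
    have expand: "3 * E * (v - 1) - 4 * z * (t - 1) = 3 * E * v - 4 * z * t - 3 * E + 4 * z" for E v z t :: real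
      by algebra
    show "3 * exp (- (2 * g n)) * (w n - 1) - 4 * x n * ((u n)\<^sup>2 - 1) =
      (joint_prob n - (single_prob n)\<^sup>2) / (x n ^ (2 * n - 3) * exp (- (2 * g n))) - (3 * exp (- (2 * g n)) - 4 + 2 * p n)"
      unfolding e y_def[symmetric] expand u w diff_divide_distrib by simp
  qed
  ultimately show ?thesis by (rule Lim_transform_eventually)
qed

text \<open>
The errors in the theorem may depend on \<open>n\<close> only; invariance under relabelling provides this for all
triples of vertices at once.
\<close>

lemma Cov_eq:
  assumes V: "s \<in> {1..n}" "a \<in> {1..n}" "b \<in> {1..n}" and ne: "s \<noteq> a" "s \<noteq> b" "a \<noteq> b"
  shows "3 \<le> n"
    and "measure_pmf.prob (directed_Gnm n (m n)) (no_path s a) = single_prob n"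
    and "Cov (measure_pmf (directed_Gnm n (m n))) (no_path s a) (no_path b s) = joint_prob n - (single_prob n)\<^sup>2"
proof -
  have "card {s, a, b} \<le> card {1..n}" using V by (intro card_mono) auto
  then show n: "3 \<le> n" using ne by simp
  have V': "1 \<in> {1..n}" "2 \<in> {1..n}" "3 \<in> {1..n}" using n by auto
  have ne': "(1::nat) \<noteq> 2" "(1::nat) \<noteq> 3" "(2::nat) \<noteq> 3" by auto
  note sym = prob_no_path_symmetric[OF m_le V V' ne ne']
  show single_prob: "measure_pmf.prob (directed_Gnm n (m n)) (no_path s a) = single_prob n"
    unfolding single_prob_def by (rule sym(1))
  show "Cov (measure_pmf (directed_Gnm n (m n))) (no_path s a) (no_path b s) = joint_prob n - (single_prob n)\<^sup>2"
    unfolding Cov_def sym(2) prob_no_path_pair_symmetric[OF m_le V ne] single_prob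
    by (simp add: joint_prob_def power2_eq_square)
qed

end

theorem theorem2p3:
  fixes m :: "nat \<Rightarrow> nat" and p :: "nat \<Rightarrow> real"
  assumes m_le: "\<And>n. m n \<le> n choose 2"
    and m_lim: "filterlim m at_top sequentially"
    and p_eq: "\<And>n. p n = real (m n) / real (n choose 2)"
    and p_liminf: "liminf (\<lambda>n. ereal (p n)) > 0"
  shows "\<exists>\<epsilon>1 \<epsilon>2 :: nat \<Rightarrow> real. \<epsilon>1 \<in> o(\<lambda>_. 1) \<and> \<epsilon>2 \<in> o(\<lambda>_. 1) \<and>
    (\<forall>n. \<forall>s \<in> {1..n}. \<forall>a \<in> {1..n}. \<forall>b \<in> {1..n}. s \<noteq> a \<and> s \<noteq> b \<and> a \<noteq> b \<longrightarrow>
       Cov (measure_pmf (directed_Gnm n (m n))) (no_path s a) (no_path b s)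
         = (3 / (4 - 2 * p n) * exp (- (2 * p n * (1 - p n) / (2 - p n)\<^sup>2)) - 1 + \<epsilon>1 n)
             * (measure_pmf.prob (directed_Gnm n (m n)) (no_path s a))\<^sup>2 \<and>
       Cov (measure_pmf (directed_Gnm n (m n))) (no_path s a) (no_path b s)
         = (3 * exp (- (2 * p n * (1 - p n) / (2 - p n)\<^sup>2)) - 4 + 2 * p n + \<epsilon>2 n)
             * (1 - p n / 2) ^ (2 * n - 3) * exp (- (2 * p n * (1 - p n) / (2 - p n)\<^sup>2)))"
proof -
  obtain \<delta> where \<delta>: "0 < ereal \<delta>" "ereal \<delta> < liminf (\<lambda>n. ereal (p n))"
    using ereal_dense2[OF p_liminf] by blast
  have "\<forall>\<^sub>F n in sequentially. ereal \<delta> < ereal (p n)"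
    using less_LiminfD[OF \<delta>(2)] .
  then have dense: "\<forall>\<^sub>F n in sequentially. \<delta> \<le> p n"
    by eventually_elim simp
  interpret dense_directed_Gnm m p \<delta>
    using m_le p_eq \<delta>(1) dense by unfold_locales auto
  have g2: "2 * p n * (1 - p n) / (2 - p n)\<^sup>2 = 2 * g n" for n by (simp add: g_def)
  define \<epsilon>1 where "\<epsilon>1 n = (joint_prob n - (single_prob n)\<^sup>2) / (single_prob n)\<^sup>2 - (3 / (4 - 2 * p n) * exp (- (2 * g n)) - 1)" for n
  define \<epsilon>2 where "\<epsilon>2 n = (joint_prob n - (single_prob n)\<^sup>2) / ((1 - p n / 2) ^ (2 * n - 3) * exp (- (2 * g n))) -
    (3 * exp (- (2 * g n)) - 4 + 2 * p n)" for n
  have "\<epsilon>1 \<in> o(\<lambda>_. 1)"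
    by (rule smalloI_tendsto) (use covariance_relative_to_square in \<open>simp_all add: \<epsilon>1_def\<close>)
  moreover have "\<epsilon>2 \<in> o(\<lambda>_. 1)"
    by (rule smalloI_tendsto) (use covariance_absolute in \<open>simp_all add: \<epsilon>2_def\<close>)
  moreover have "Cov (measure_pmf (directed_Gnm n (m n))) (no_path s a) (no_path b s)
         = (3 / (4 - 2 * p n) * exp (- (2 * g n)) - 1 + \<epsilon>1 n)
             * (measure_pmf.prob (directed_Gnm n (m n)) (no_path s a))\<^sup>2 \<and>
       Cov (measure_pmf (directed_Gnm n (m n))) (no_path s a) (no_path b s)
         = (3 * exp (- (2 * g n)) - 4 + 2 * p n + \<epsilon>2 n) * (1 - p n / 2) ^ (2 * n - 3) * exp (- (2 * g n))"
    if V: "s \<in> {1..n}" "a \<in> {1..n}" "b \<in> {1..n}" and ne: "s \<noteq> a" "s \<noteq> b" "a \<noteq> b" for n s a b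
  proof -
    note eq = Cov_eq[OF V ne]
    have "single_prob n \<noteq> 0" using single_prob_pos[of n] eq(1) by simp
    moreover have "(1 - p n / 2) ^ (2 * n - 3) \<noteq> 0" using x_bounds(2)[of n] by simp
    ultimately show ?thesis unfolding eq(2,3) \<epsilon>1_def \<epsilon>2_def by (simp add: mult.assoc)
  qed
  ultimately show ?thesis unfolding g2 by blast
qed

end
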